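(* Consider the high order IMEX Runge-Kutta scheme which, given $(\rho^n,g^n)$ with $\langle g^n\rangle_V=0$, computes for $j=1,\dots,s$ $$\rho^{(j)}=\rho^n-\sum_{k=1}^{j}a_{jk}\frac{\Delta t}{\epsilon}\nabla_x\cdot\langle v\,g^{(k)}\rangle_V,$$ $$g^{(j)}=g^n-\sum_{k=1}^{j-1}\tilde a_{jk}\frac{\Delta t}{\epsilon}(I-\Pi)(v\cdot\nabla_x g^{(k)})-\sum_{k=1}^{j}a_{jk}\frac{\Delta t}{\epsilon}vM\cdot\nabla_x\rho^{(k)}+\sum_{k=1}^{j}a_{jk}\frac{\Delta t}{\epsilon^2}Lg^{(k)},$$ and sets $\rho^{n+1}=\rho^{(s)}$, $g^{n+1}=g^{(s)}$, where the (globally stiffly accurate) IMEX Runge-Kutta method is either of type A with initial data $g^0=O(1)$, or of type CK-ARS with well-prepared initial data $g^0=O(\epsilon)$. Then, in the limit $\epsilon\to0$ (with $\Delta t$ fixed), at every time step $n$ the scheme degenerates to the following scheme for the diffusion equation $\partial_t\rho-\nabla_x\cdot(\kappa\nabla_x\rho)=0$: $$\rho^{(j)}=\rho^n+\sum_{k=1}^{j}a_{jk}\,\Delta t\,\nabla_x\cdot\big(\kappa\nabla_x\rho^{(k)}\big),\qquad j=1,\dots,s,\qquad \kappa=-\langle v\otimes L^{-1}(vM)\rangle_V .$$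
   Context: Kinetic setting. $\Omega\subset\mathbb{R}^d$ is the position domain with periodic boundary conditions, $V\subseteq\mathbb{R}^d$ is the velocity space with measure $d\mu(v)$, and $M=M(v)$ is a positive even equilibrium. For a function $h$ of $v$, $\langle h\rangle_V=\int_V h\,d\mu\big/\int_V M\,d\mu$; in particular $\langle M\rangle_V=1$ and $\langle vM\rangle_V=0$. $\Pi h=\langle h\rangle_V M$. $L$ is a linear operator acting only on the variable $v$, non-positive and self-adjoint in $L^2(V,M^{-1}d\mu)$, with null space $\mathrm{Span}(M)$ and range $\{f:\langle f\rangle_V=0\}$, and invariant under orthogonal transformations of $\mathbb{R}^d$; $L^{-1}$ is its pseudo-inverse, i.e. its inverse on its range. The scheme approximates the micro-macro system $\partial_t\rho+\frac1\epsilon\nabla_x\cdot\langle vg\rangle_V=0$, $\partial_t g+\frac1\epsilon(I-\Pi)(v\cdot\nabla_xg)+\frac1\epsilon vM\cdot\nabla_x\rho=\frac1{\epsilon^2}Lg$, with $\rho=\rho(t,x)$, $g=g(t,x,v)$, $\langle g\rangle_V=0$. IMEX Runge-Kutta method. It is given by $s\times s$ real matrices $(\tilde a_{jk})$ (strictly lower triangular, explicit part) and $(a_{jk})$ (lower triangular, implicit part) and weights $\tilde b,b$, with $\tilde c_i=\sum_{j=1}^{i-1}\tilde a_{ij}$, $c_i=\sum_{j=1}^{i}a_{ij}$. It is globally stiffly accurate (GSA) if $c_s=\tilde c_s=1$, $a_{sj}=b_j$, $\tilde a_{sj}=\tilde b_j$ for all $j$. It is of type A if $(a_{jk})$ is invertible.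 It is of type CK-ARS if the first row and the first column of $(a_{jk})$ are zero and the submatrix obtained by deleting the first row and column is invertible. Sums over empty ranges are zero. Asymptotic conventions. $O(\epsilon^p)$ is understood as $\epsilon\to0$ with $\Delta t$ fixed, for $\epsilon$-dependent families of functions. All functions are assumed sufficiently smooth, with $\rho^n,\rho^{(j)}$ being $O(1)$, and $O$-estimates are understood to be stable under $\nabla_x$, multiplication by $v$, $\Pi$, $\langle\cdot\rangle_V$, and (on functions with $\langle\cdot\rangle_V=0$) under $L^{-1}$ and $(\epsilon^2I-a_{jj}\Delta tL)^{-1}$ with $a_{jj}\ne0$. "The scheme degenerates to" a set of relations means that its stage values satisfy these relations up to $O(\epsilon)$ remainders. *)

theory Defs
  imports "HOL-Analysis.Analysis" "HOL-Library.Landau_Symbols" "Jordan_Normal_Form.Determinant"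
begin

no_notation Matrix.vec_index (infixl "$" 100)

section \<open>Differential operators and velocity averages\<close>

definition pderivative :: "'d::finite \<Rightarrow> (real^'d \<Rightarrow> real) \<Rightarrow> real^'d \<Rightarrow> real" where
  "pderivative i f x = frechet_derivative f (at x) (axis i 1)"

definition grad :: "(real^'d \<Rightarrow> real) \<Rightarrow> real^'d \<Rightarrow> real^'d::finite" where
  "grad f x = (\<chi> i. pderivative i f x)"

definition divergence :: "(real^'d \<Rightarrow> real^'d) \<Rightarrow> real^'d::finite \<Rightarrow> real" where
  "divergence F x = (\<Sum>i\<in>UNIV. pderivative i (\<lambda>y. F y $ i) x)"

definition avg :: "(real^'d::finite) measure \<Rightarrow> (real^'d \<Rightarrow> real) \<Rightarrow> (real^'d \<Rightarrow> real) \<Rightarrow> real" where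
  "avg \<mu> M h = (LINT v|\<mu>. h v) / (LINT v|\<mu>. M v)"

definition Proj :: "(real^'d::finite) measure \<Rightarrow> (real^'d \<Rightarrow> real) \<Rightarrow> (real^'d \<Rightarrow> real) \<Rightarrow> real^'d \<Rightarrow> real" where
  "Proj \<mu> M h v = avg \<mu> M h * M v"

text \<open>The flux \<open>x \<mapsto> \<langle>v g(x, v)\<rangle>\<close> and the transport term \<open>v \<cdot> \<nabla>\<^sub>x g\<close> of a function
  \<open>g\<close> of position and velocity.\<close>

definition flux :: "(real^'d::finite) measure \<Rightarrow> (real^'d \<Rightarrow> real) \<Rightarrow> ((real^'d) \<times> (real^'d) \<Rightarrow> real) \<Rightarrow> real^'d \<Rightarrow> real^'d" where
  "flux \<mu> M g x = (\<chi> i. avg \<mu> M (\<lambda>v. v $ i * g (x, v)))"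

definition transport :: "((real^'d::finite) \<times> (real^'d) \<Rightarrow> real) \<Rightarrow> real^'d \<Rightarrow> real^'d \<Rightarrow> real" where
  "transport g x v = inner v (grad (\<lambda>y. g (y, v)) x)"

section \<open>The equilibrium and the collision operator\<close>

text \<open>Square-integrable functions and the inner product for the measure \<open>M\<^sup>-\<^sup>1 d\<mu>\<close>. Functions of
  the velocity only matter on \<open>V = space \<mu>\<close> and up to \<open>\<mu>\<close>-null sets.\<close>

definition wL2 :: "(real^'d::finite) measure \<Rightarrow> (real^'d \<Rightarrow> real) \<Rightarrow> (real^'d \<Rightarrow> real) set" where
  "wL2 \<mu> M = {f \<in> borel_measurable \<mu>. integrable \<mu> (\<lambda>v. (f v)\<^sup>2 / M v)}"

definition winner :: "(real^'d::finite) measure \<Rightarrow> (real^'d \<Rightarrow> real) \<Rightarrow> (real^'d \<Rightarrow> real) \<Rightarrow> (real^'d \<Rightarrow> real) \<Rightarrow> real" where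
  "winner \<mu> M f h = (LINT v|\<mu>. f v * h v / M v)"

locale equilibrium =
  fixes \<mu> :: "(real^'d::finite) measure" and M :: "real^'d \<Rightarrow> real"
  assumes sets_velocity: "sets \<mu> = sets (restrict_space borel (space \<mu>))"
    and M_measurable: "M \<in> borel_measurable \<mu>"
    and M_pos: "\<And>v. v \<in> space \<mu> \<Longrightarrow> 0 < M v"
    and M_even: "\<And>v. v \<in> space \<mu> \<Longrightarrow> - v \<in> space \<mu> \<and> M (- v) = M v"
    and M_integrable: "integrable \<mu> M"
    and mass_pos: "0 < (LINT v|\<mu>. M v)"
    and vM_wL2: "\<And>i. (\<lambda>v. v $ i * M v) \<in> wL2 \<mu> M"
    and vM_avg: "\<And>i. avg \<mu> M (\<lambda>v. v $ i * M v) = 0"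

text \<open>\<open>L\<close> may be unbounded, with domain \<open>D\<close>. The condition \<open>L_selfadjoint\<close> says that the graph of
  \<open>L\<close> is the graph of its adjoint, domain included; \<open>L_dense\<close> makes the adjoint well defined.\<close>

locale collision_operator = equilibrium \<mu> M
  for \<mu> :: "(real^'d::finite) measure" and M :: "real^'d \<Rightarrow> real" +
  fixes D :: "(real^'d \<Rightarrow> real) set" and L :: "(real^'d \<Rightarrow> real) \<Rightarrow> real^'d \<Rightarrow> real"
  assumes L_domain: "D \<subseteq> wL2 \<mu> M"
    and L_maps_to: "\<And>f. f \<in> D \<Longrightarrow> L f \<in> wL2 \<mu> M"
    and L_linear: "\<And>f h a b. f \<in> D \<Longrightarrow> h \<in> D \<Longrightarrow>
        (\<lambda>v. a * f v + b * h v) \<in> D \<and>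
        (AE v in \<mu>. L (\<lambda>w. a * f w + b * h w) v = a * L f v + b * L h v)"
    and L_dense: "\<And>f e. f \<in> wL2 \<mu> M \<Longrightarrow> 0 < e \<Longrightarrow>
        \<exists>h\<in>D. winner \<mu> M (\<lambda>v. f v - h v) (\<lambda>v. f v - h v) < e"
    and L_nonpositive: "\<And>f. f \<in> D \<Longrightarrow> winner \<mu> M (L f) f \<le> 0"
    and L_selfadjoint: "\<And>h w. h \<in> wL2 \<mu> M \<Longrightarrow> w \<in> wL2 \<mu> M \<Longrightarrow>
        (h \<in> D \<and> (AE v in \<mu>. L h v = w v)) \<longleftrightarrow>
        (\<forall>f\<in>D. winner \<mu> M (L f) h = winner \<mu> M f w)"
    and L_null_space: "\<And>f. f \<in> wL2 \<mu> M \<Longrightarrow>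
        (f \<in> D \<and> (AE v in \<mu>. L f v = 0)) \<longleftrightarrow> (\<exists>c. AE v in \<mu>. f v = c * M v)"
    and L_range: "\<And>f. f \<in> wL2 \<mu> M \<Longrightarrow>
        (\<exists>h\<in>D. AE v in \<mu>. L h v = f v) \<longleftrightarrow> avg \<mu> M f = 0"
    and L_isotropic: "\<And>Q. orthogonal_transformation Q \<Longrightarrow> Q ` space \<mu> = space \<mu> \<and>
        (\<forall>f\<in>D. f \<circ> Q \<in> D \<and> (AE v in \<mu>. L (f \<circ> Q) v = L f (Q v)))"

text \<open>\<open>is_inverse_image \<mu> M D T f h\<close>: on the functions of average zero, \<open>h = T\<^sup>-\<^sup>1 f\<close>
  (as classes modulo \<open>\<mu>\<close>-null sets).\<close>

definition is_inverse_image :: "(real^'d::finite) measure \<Rightarrow> (real^'d \<Rightarrow> real) \<Rightarrow> (real^'d \<Rightarrow> real) set \<Rightarrow>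
    ((real^'d \<Rightarrow> real) \<Rightarrow> real^'d \<Rightarrow> real) \<Rightarrow> (real^'d \<Rightarrow> real) \<Rightarrow> (real^'d \<Rightarrow> real) \<Rightarrow> bool" where
  "is_inverse_image \<mu> M D T f h \<longleftrightarrow> h \<in> D \<and> avg \<mu> M h = 0 \<and> (AE v in \<mu>. T h v = f v)"

definition pseudo_inverse :: "(real^'d::finite) measure \<Rightarrow> (real^'d \<Rightarrow> real) \<Rightarrow> (real^'d \<Rightarrow> real) set \<Rightarrow>
    ((real^'d \<Rightarrow> real) \<Rightarrow> real^'d \<Rightarrow> real) \<Rightarrow> (real^'d \<Rightarrow> real) \<Rightarrow> real^'d \<Rightarrow> real" where
  "pseudo_inverse \<mu> M D L f = (SOME h. is_inverse_image \<mu> M D L f h)"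

definition diffusion_matrix :: "(real^'d::finite) measure \<Rightarrow> (real^'d \<Rightarrow> real) \<Rightarrow> (real^'d \<Rightarrow> real) set \<Rightarrow>
    ((real^'d \<Rightarrow> real) \<Rightarrow> real^'d \<Rightarrow> real) \<Rightarrow> real^'d^'d" where
  "diffusion_matrix \<mu> M D L =
     (\<chi> i k. - avg \<mu> M (\<lambda>v. v $ i * pseudo_inverse \<mu> M D L (\<lambda>w. w $ k * M w) v))"

section \<open>Asymptotic estimates\<close>

definition linear_space :: "('z \<Rightarrow> real) set \<Rightarrow> bool" where
  "linear_space S \<longleftrightarrow> S \<noteq> {} \<and> (\<forall>f\<in>S. \<forall>h\<in>S. \<forall>a b. (\<lambda>z. a * f z + b * h z) \<in> S)"

definition seminorm_on :: "('z \<Rightarrow> real) set \<Rightarrow> (('z \<Rightarrow> real) \<Rightarrow> real) \<Rightarrow> bool" where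
  "seminorm_on S q \<longleftrightarrow> (\<forall>f\<in>S. 0 \<le> q f) \<and> (\<forall>f\<in>S. \<forall>a. q (\<lambda>z. a * f z) = \<bar>a\<bar> * q f) \<and>
     (\<forall>f\<in>S. \<forall>h\<in>S. q (\<lambda>z. f z + h z) \<le> q f + q h)"

text \<open>\<open>is_O S P p f\<close>: the family \<open>f \<epsilon>\<close>, \<open>\<epsilon> \<rightarrow> 0+\<close>, of members of the function space \<open>S\<close> is
  \<open>O(\<epsilon>\<^sup>p)\<close> in each of the seminorms \<open>P\<close>.\<close>

definition is_O :: "('z \<Rightarrow> real) set \<Rightarrow> (('z \<Rightarrow> real) \<Rightarrow> real) set \<Rightarrow> nat \<Rightarrow> (real \<Rightarrow> 'z \<Rightarrow> real) \<Rightarrow> bool" where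
  "is_O S P p f \<longleftrightarrow> (\<forall>\<^sub>F \<epsilon> in at_right 0. f \<epsilon> \<in> S) \<and>
     (\<forall>q\<in>P. (\<lambda>\<epsilon>. q (f \<epsilon>)) \<in> O[at_right 0](\<lambda>\<epsilon>. \<epsilon> ^ p))"

text \<open>Constant families are \<open>O(1)\<close>, so \<open>O_stable\<close> also says that \<open>T\<close> maps \<open>S\<close> into \<open>S'\<close>.\<close>

definition O_stable :: "('z \<Rightarrow> real) set \<Rightarrow> (('z \<Rightarrow> real) \<Rightarrow> real) set \<Rightarrow>
    ('y \<Rightarrow> real) set \<Rightarrow> (('y \<Rightarrow> real) \<Rightarrow> real) set \<Rightarrow> (('z \<Rightarrow> real) \<Rightarrow> 'y \<Rightarrow> real) \<Rightarrow> bool" where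
  "O_stable S P S' P' T \<longleftrightarrow> (\<forall>p f. is_O S P p f \<longrightarrow> is_O S' P' p (\<lambda>\<epsilon>. T (f \<epsilon>)))"

text \<open>Stability under the inverse of an operator \<open>T \<epsilon>\<close> in the velocity, on functions with average
  zero: the inverse image of a smooth \<open>O(\<epsilon>\<^sup>p)\<close> family has smooth representatives, and all of them
  are \<open>O(\<epsilon>\<^sup>p)\<close>.\<close>

definition inverse_O_stable :: "(real^'d::finite) measure \<Rightarrow> (real^'d \<Rightarrow> real) \<Rightarrow> (real^'d \<Rightarrow> real) set \<Rightarrow>
    ((real^'d) \<times> (real^'d) \<Rightarrow> real) set \<Rightarrow> (((real^'d) \<times> (real^'d) \<Rightarrow> real) \<Rightarrow> real) set \<Rightarrow>
    (real \<Rightarrow> (real^'d \<Rightarrow> real) \<Rightarrow> real^'d \<Rightarrow> real) \<Rightarrow> bool" where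
  "inverse_O_stable \<mu> M D G PG T \<longleftrightarrow>
     (\<forall>p f. is_O G PG p f \<and> (\<forall>\<^sub>F \<epsilon> in at_right 0. \<forall>x. avg \<mu> M (\<lambda>v. f \<epsilon> (x, v)) = 0) \<longrightarrow>
       (let sol = (\<lambda>h. \<forall>\<^sub>F \<epsilon> in at_right 0. h \<epsilon> \<in> G \<and>
              (\<forall>x. is_inverse_image \<mu> M D (T \<epsilon>) (\<lambda>v. f \<epsilon> (x, v)) (\<lambda>v. h \<epsilon> (x, v))))
        in (\<exists>h. sol h) \<and> (\<forall>h. sol h \<longrightarrow> is_O G PG p h)))"

definition periodic_on_box :: "real^'d \<Rightarrow> real^'d \<Rightarrow> (real^'d::finite \<Rightarrow> real) \<Rightarrow> bool" where
  "periodic_on_box lo hi f \<longleftrightarrow> (\<forall>i x. f (x + axis i (hi $ i - lo $ i)) = f x)"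

text \<open>The position domain is the periodic box \<open>box lo hi\<close>. \<open>R\<close> and \<open>G\<close> are the classes of smooth
  functions of \<open>x\<close> and of \<open>(x, v)\<close>; \<open>O\<close>-estimates are measured by seminorms \<open>PR\<close> and \<open>PG\<close>.
  Differentiability and closedness under derivatives make all members infinitely differentiable
  in \<open>x\<close>. Stability under the projection \<open>h \<mapsto> \<langle>h\<rangle> M\<close> is stated for its two factors, the average
  and the map \<open>\<rho> \<mapsto> \<rho> M\<close>.\<close>

locale asymptotic_setting = collision_operator \<mu> M D L
  for \<mu> :: "(real^'d::finite) measure" and M :: "real^'d \<Rightarrow> real"
    and D :: "(real^'d \<Rightarrow> real) set" and L :: "(real^'d \<Rightarrow> real) \<Rightarrow> real^'d \<Rightarrow> real" +
  fixes lo hi :: "real^'d"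
    and R :: "(real^'d \<Rightarrow> real) set" and PR :: "((real^'d \<Rightarrow> real) \<Rightarrow> real) set"
    and G :: "((real^'d) \<times> (real^'d) \<Rightarrow> real) set" and PG :: "(((real^'d) \<times> (real^'d) \<Rightarrow> real) \<Rightarrow> real) set"
  assumes box_nonempty: "\<And>i. lo $ i < hi $ i"
    and R_linear: "linear_space R"
    and G_linear: "linear_space G"
    and R_seminorms: "\<And>q. q \<in> PR \<Longrightarrow> seminorm_on R q"
    and G_seminorms: "\<And>q. q \<in> PG \<Longrightarrow> seminorm_on G q"
    and R_functions: "\<And>r. r \<in> R \<Longrightarrow> periodic_on_box lo hi r \<and> (\<forall>x. r differentiable (at x))"
    and G_functions: "\<And>f v. f \<in> G \<Longrightarrow> v \<in> space \<mu> \<Longrightarrow>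
        periodic_on_box lo hi (\<lambda>x. f (x, v)) \<and> (\<forall>x. (\<lambda>y. f (y, v)) differentiable (at x))"
    and G_wL2: "\<And>f x. f \<in> G \<Longrightarrow> (\<lambda>v. f (x, v)) \<in> wL2 \<mu> M"
    and stable_derivative_R: "\<And>i. O_stable R PR R PR (pderivative i)"
    and stable_derivative_G: "\<And>i. O_stable G PG G PG (\<lambda>f (x, v). pderivative i (\<lambda>y. f (y, v)) x)"
    and stable_velocity: "\<And>i. O_stable G PG G PG (\<lambda>f (x, v). v $ i * f (x, v))"
    and stable_average: "O_stable G PG R PR (\<lambda>f x. avg \<mu> M (\<lambda>v. f (x, v)))"
    and stable_equilibrium: "O_stable R PR G PG (\<lambda>r (x, v). r x * M v)"
    and stable_pseudo_inverse: "inverse_O_stable \<mu> M D G PG (\<lambda>_. L)"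

section \<open>IMEX Runge-Kutta methods\<close>

text \<open>Stages are numbered from \<open>0\<close> to \<open>s - 1\<close>. \<open>At\<close>, \<open>bt\<close> are the explicit coefficients and
  weights, \<open>A\<close>, \<open>b\<close> the implicit ones.\<close>

locale imex_method =
  fixes s :: nat and At A :: "real mat"
  assumes stages: "0 < s"
    and explicit_dim: "At \<in> carrier_mat s s"
    and implicit_dim: "A \<in> carrier_mat s s"
    and explicit_part: "\<And>j k. j < s \<Longrightarrow> k < s \<Longrightarrow> j \<le> k \<Longrightarrow> At $$ (j, k) = 0"
    and implicit_part: "\<And>j k. j < s \<Longrightarrow> k < s \<Longrightarrow> j < k \<Longrightarrow> A $$ (j, k) = 0"

definition globally_stiffly_accurate :: "nat \<Rightarrow> real mat \<Rightarrow> real mat \<Rightarrow> (nat \<Rightarrow> real) \<Rightarrow> (nat \<Rightarrow> real) \<Rightarrow> bool" where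
  "globally_stiffly_accurate s At A bt b \<longleftrightarrow>
     (\<Sum>k\<le>s - 1. A $$ (s - 1, k)) = 1 \<and> (\<Sum>k<s - 1. At $$ (s - 1, k)) = 1 \<and>
     (\<forall>j<s. A $$ (s - 1, j) = b j \<and> At $$ (s - 1, j) = bt j)"

definition type_A :: "real mat \<Rightarrow> bool" where
  "type_A A \<longleftrightarrow> invertible_mat A"

definition type_CK_ARS :: "nat \<Rightarrow> real mat \<Rightarrow> bool" where
  "type_CK_ARS s A \<longleftrightarrow> (\<forall>j<s. A $$ (0, j) = 0 \<and> A $$ (j, 0) = 0) \<and> invertible_mat (mat_delete A 0 0)"

text \<open>One time step from \<open>(rn, gn)\<close> to \<open>(rn', gn')\<close> with stage values \<open>rs j\<close>, \<open>gs j\<close>.\<close>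

definition imex_step :: "(real^'d::finite) measure \<Rightarrow> (real^'d \<Rightarrow> real) \<Rightarrow> (real^'d \<Rightarrow> real) set \<Rightarrow>
    ((real^'d \<Rightarrow> real) \<Rightarrow> real^'d \<Rightarrow> real) \<Rightarrow> nat \<Rightarrow> real mat \<Rightarrow> real mat \<Rightarrow> real \<Rightarrow> real \<Rightarrow>
    (real^'d \<Rightarrow> real) \<Rightarrow> ((real^'d) \<times> (real^'d) \<Rightarrow> real) \<Rightarrow>
    (nat \<Rightarrow> real^'d \<Rightarrow> real) \<Rightarrow> (nat \<Rightarrow> (real^'d) \<times> (real^'d) \<Rightarrow> real) \<Rightarrow>
    (real^'d \<Rightarrow> real) \<Rightarrow> ((real^'d) \<times> (real^'d) \<Rightarrow> real) \<Rightarrow> bool" where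
  "imex_step \<mu> M D L s At A dt \<epsilon> rn gn rs gs rn' gn' \<longleftrightarrow>
     (\<forall>j<s. \<forall>x. rs j x = rn x - (\<Sum>k\<le>j. A $$ (j, k) * (dt / \<epsilon>) * divergence (flux \<mu> M (gs k)) x)) \<and>
     (\<forall>j<s. \<forall>x. (\<lambda>v. gs j (x, v)) \<in> D) \<and>
     (\<forall>j<s. \<forall>x. AE v in \<mu>. gs j (x, v) = gn (x, v)
        - (\<Sum>k<j. At $$ (j, k) * (dt / \<epsilon>) *
             (transport (gs k) x v - Proj \<mu> M (transport (gs k) x) v))
        - (\<Sum>k\<le>j. A $$ (j, k) * (dt / \<epsilon>) * (inner (M v *\<^sub>R v) (grad (rs k) x)))
        + (\<Sum>k\<le>j. A $$ (j, k) * (dt / \<epsilon>\<^sup>2) * L (\<lambda>w. gs k (x, w)) v)) \<and>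
     rn' = rs (s - 1) \<and> gn' = gs (s - 1)"

end

theory Submission
  imports Defs
begin

text \<open>
  Multiplying the equation of stage \<open>j\<close> by \<open>\<epsilon>\<^sup>2\<close> gives
  \<open>(\<epsilon>\<^sup>2 - a\<^bsub>jj\<^esub> \<Delta>t L) g\<^sup>(\<^sup>j\<^sup>) = O(\<epsilon>)\<close>, provided that \<open>L g\<^sup>(\<^sup>k\<^sup>)\<close> is under control for the earlier
  stages. This cannot come from continuity of \<open>L\<close>, which is unbounded; instead each stage equation
  is read a second time, as a formula for \<open>L g\<^sup>(\<^sup>j\<^sup>)\<close>. By induction on \<open>j\<close> one gets simultaneously
  \<open>g\<^sup>(\<^sup>j\<^sup>) = O(\<epsilon>)\<close> and \<open>L g\<^sup>(\<^sup>j\<^sup>) = \<epsilon> v M \<cdot> \<nabla>\<rho>\<^sup>(\<^sup>j\<^sup>) + O(\<epsilon>\<^sup>2)\<close> whenever \<open>a\<^bsub>jj\<^esub> \<noteq> 0\<close>. Applying \<open>L\<^sup>-\<^sup>1\<close> to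
  the latter, the flux of \<open>g\<^sup>(\<^sup>j\<^sup>)\<close> is \<open>- \<epsilon> \<kappa> \<nabla>\<rho>\<^sup>(\<^sup>j\<^sup>) + O(\<epsilon>\<^sup>2)\<close>, which turns the equation for \<open>\<rho>\<^sup>(\<^sup>j\<^sup>)\<close> into
  the limit scheme. By stiff accuracy \<open>g\<^sup>n\<^sup>+\<^sup>1\<close> is the last stage, hence \<open>O(\<epsilon>)\<close>, and the next step has
  well-prepared data.
\<close>

subsection \<open>Calculus of asymptotic estimates\<close>

text \<open>Both clauses of \<open>is_O\<close> are statements about small positive \<epsilon>, so
  families may be replaced by ones that agree only eventually, as the scheme itself holds only
  eventually.\<close>

lemma is_O_cong:
  assumes "\<forall>\<^sub>F \<epsilon> in at_right 0. f \<epsilon> = h \<epsilon>"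
  shows "is_O S P p f \<longleftrightarrow> is_O S P p h"
proof -
  have "is_O S P p h" if "\<forall>\<^sub>F \<epsilon> in at_right 0. f \<epsilon> = h \<epsilon>" "is_O S P p f" for f h
    unfolding is_O_def
  proof (intro conjI ballI)
    show "\<forall>\<^sub>F \<epsilon> in at_right 0. h \<epsilon> \<in> S"
      using that unfolding is_O_def by (auto elim: eventually_elim2)
    fix q assume "q \<in> P"
    then have "(\<lambda>\<epsilon>. q (f \<epsilon>)) \<in> O[at_right 0](\<lambda>\<epsilon>. \<epsilon> ^ p)" using that unfolding is_O_def by auto
    moreover have "\<forall>\<^sub>F \<epsilon> in at_right 0. q (f \<epsilon>) = q (h \<epsilon>)"
      using that(1) by eventually_elim simp
    ultimately show "(\<lambda>\<epsilon>. q (h \<epsilon>)) \<in> O[at_right 0](\<lambda>\<epsilon>. \<epsilon> ^ p)"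
      by (simp add: landau_o.big.in_cong)
  qed
  moreover have "\<forall>\<^sub>F \<epsilon> in at_right 0. h \<epsilon> = f \<epsilon>" using assms by eventually_elim simp
  ultimately show ?thesis using assms by blast
qed

lemma is_O_stable: "O_stable S P S' P' T \<Longrightarrow> is_O S P p f \<Longrightarrow> is_O S' P' p (\<lambda>\<epsilon>. T (f \<epsilon>))"
  unfolding O_stable_def by blast

lemma O_stable_maps:
  assumes "O_stable S P S' P' T" "f \<in> S"
  shows "T f \<in> S'"
proof -
  have "is_O S P 0 (\<lambda>_. f)" using assms(2) by (simp add: is_O_def)
  then have "is_O S' P' 0 (\<lambda>_. T f)" using assms(1) by (rule is_O_stable[rotated])
  then show ?thesis by (simp add: is_O_def)
qed

lemma linear_spaceD: "linear_space S \<Longrightarrow> f \<in> S \<Longrightarrow> h \<in> S \<Longrightarrow> (\<lambda>z. a * f z + b * h z) \<in> S"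
  unfolding linear_space_def by blast

lemma linear_space_scale: "linear_space S \<Longrightarrow> f \<in> S \<Longrightarrow> (\<lambda>z. a * f z) \<in> S"
  using linear_spaceD[of S f f a 0] by simp

lemma linear_space_zero: "linear_space S \<Longrightarrow> (\<lambda>z. 0) \<in> S"
  using linear_space_scale[of S _ 0] unfolding linear_space_def by auto

text \<open>Kept abstract because it is instantiated twice: as \<open>macro\<close> for functions of
  position and as \<open>micro\<close> for functions of position and velocity.\<close>

locale seminormed_space =
  fixes S :: "('z \<Rightarrow> real) set" and P :: "(('z \<Rightarrow> real) \<Rightarrow> real) set"
  assumes linear: "linear_space S"
    and seminorms: "\<And>q. q \<in> P \<Longrightarrow> seminorm_on S q"
begin

text \<open>Homogeneity of the seminorms reduces the claim to scalar growth. The factor may depend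
  on \<epsilon>, so constants, powers, division by \<epsilon> and loss of order are all special
  cases.\<close>

lemma is_O_scale:
  assumes f: "is_O S P p f" and c: "(\<lambda>\<epsilon>. c \<epsilon> * \<epsilon> ^ p) \<in> O[at_right 0](\<lambda>\<epsilon>. \<epsilon> ^ m)"
  shows "is_O S P m (\<lambda>\<epsilon> z. c \<epsilon> * f \<epsilon> z)"
  unfolding is_O_def
proof (intro conjI ballI)
  have ev: "\<forall>\<^sub>F \<epsilon> in at_right 0. f \<epsilon> \<in> S" using f by (simp add: is_O_def)
  then show "\<forall>\<^sub>F \<epsilon> in at_right 0. (\<lambda>z. c \<epsilon> * f \<epsilon> z) \<in> S"
    by eventually_elim (rule linear_space_scale[OF linear])
  fix q assume q: "q \<in> P"
  then have "(\<lambda>\<epsilon>. q (f \<epsilon>)) \<in> O[at_right 0](\<lambda>\<epsilon>. \<epsilon> ^ p)" using f by (simp add: is_O_def)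
  then have "(\<lambda>\<epsilon>. c \<epsilon> * q (f \<epsilon>)) \<in> O[at_right 0](\<lambda>\<epsilon>. c \<epsilon> * \<epsilon> ^ p)" by simp
  then have *: "(\<lambda>\<epsilon>. c \<epsilon> * q (f \<epsilon>)) \<in> O[at_right 0](\<lambda>\<epsilon>. \<epsilon> ^ m)"
    using c by (rule landau_o.big_trans)
  have "\<forall>\<^sub>F \<epsilon> in at_right 0. norm (q (\<lambda>z. c \<epsilon> * f \<epsilon> z)) \<le> norm (c \<epsilon> * q (f \<epsilon>))"
    using ev by eventually_elim (use seminorms[OF q] in \<open>auto simp: seminorm_on_def abs_mult\<close>)
  then show "(\<lambda>\<epsilon>. q (\<lambda>z. c \<epsilon> * f \<epsilon> z)) \<in> O[at_right 0](\<lambda>\<epsilon>. \<epsilon> ^ m)"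
    using * by (rule landau_o.big_trans[OF landau_o.big_mono])
qed

lemma is_O_add:
  assumes f: "is_O S P p f" and h: "is_O S P p h"
  shows "is_O S P p (\<lambda>\<epsilon> z. f \<epsilon> z + h \<epsilon> z)"
  unfolding is_O_def
proof (intro conjI ballI)
  have ev: "\<forall>\<^sub>F \<epsilon> in at_right 0. f \<epsilon> \<in> S \<and> h \<epsilon> \<in> S"
    using f h by (simp add: is_O_def eventually_conj)
  then show "\<forall>\<^sub>F \<epsilon> in at_right 0. (\<lambda>z. f \<epsilon> z + h \<epsilon> z) \<in> S"
    by eventually_elim (use linear_spaceD[OF linear, of _ _ 1 1] in auto)
  fix q assume q: "q \<in> P"
  then have *: "(\<lambda>\<epsilon>. q (f \<epsilon>) + q (h \<epsilon>)) \<in> O[at_right 0](\<lambda>\<epsilon>. \<epsilon> ^ p)"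
    using f h by (intro sum_in_bigo) (simp_all add: is_O_def)
  have "\<forall>\<^sub>F \<epsilon> in at_right 0. norm (q (\<lambda>z. f \<epsilon> z + h \<epsilon> z)) \<le> norm (q (f \<epsilon>) + q (h \<epsilon>))"
    using ev
  proof eventually_elim
    case (elim \<epsilon>)
    then have "(\<lambda>z. f \<epsilon> z + h \<epsilon> z) \<in> S" using linear_spaceD[OF linear, of "f \<epsilon>" "h \<epsilon>" 1 1] by auto
    then have "0 \<le> q (\<lambda>z. f \<epsilon> z + h \<epsilon> z)" "q (\<lambda>z. f \<epsilon> z + h \<epsilon> z) \<le> q (f \<epsilon>) + q (h \<epsilon>)"
      using seminorms[OF q] elim by (simp_all add: seminorm_on_def)
    then show ?case by simp
  qed
  then show "(\<lambda>\<epsilon>. q (\<lambda>z. f \<epsilon> z + h \<epsilon> z)) \<in> O[at_right 0](\<lambda>\<epsilon>. \<epsilon> ^ p)"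
    using * by (rule landau_o.big_trans[OF landau_o.big_mono])
qed

lemma is_O_const_scale: "is_O S P p f \<Longrightarrow> is_O S P p (\<lambda>\<epsilon> z. c * f \<epsilon> z)"
  by (rule is_O_scale) (auto intro: landau_o.big.cmult_in_iff[THEN iffD2] landau_o.bigI[of 1])

lemma is_O_power_scale: "is_O S P p f \<Longrightarrow> is_O S P (m + p) (\<lambda>\<epsilon> z. \<epsilon> ^ m * f \<epsilon> z)"
  by (rule is_O_scale) (auto simp: power_add intro: landau_o.bigI[of 1])

lemma is_O_divide:
  assumes "is_O S P (Suc p) f"
  shows "is_O S P p (\<lambda>\<epsilon> z. f \<epsilon> z / \<epsilon>)"
proof -
  have "\<forall>\<^sub>F \<epsilon>::real in at_right 0. norm (1 / \<epsilon> * \<epsilon> ^ Suc p) \<le> norm (\<epsilon> ^ p)"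
    using eventually_at_right_less[of "0::real"] by eventually_elim simp
  then have "is_O S P p (\<lambda>\<epsilon> z. 1 / \<epsilon> * f \<epsilon> z)"
    by (rule is_O_scale[OF assms landau_o.big_mono])
  then show ?thesis by simp
qed

lemma is_O_mono:
  assumes "is_O S P p f" "m \<le> p"
  shows "is_O S P m f"
proof -
  have "\<forall>\<^sub>F \<epsilon>::real in at_right 0. \<epsilon> < 1 \<and> 0 < \<epsilon>"
    using eventually_at_right_less[of "0::real"] eventually_at_rightI[of 0 1 "\<lambda>\<epsilon>::real. \<epsilon> < 1"]
    by (simp add: eventually_conj)
  then have "\<forall>\<^sub>F \<epsilon>::real in at_right 0. norm (1 * \<epsilon> ^ p) \<le> norm (\<epsilon> ^ m)"
    by eventually_elim (use assms(2) in \<open>auto intro: power_decreasing\<close>)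
  then have "is_O S P m (\<lambda>\<epsilon> z. 1 * f \<epsilon> z)"
    by (rule is_O_scale[OF assms(1) landau_o.big_mono])
  then show ?thesis by simp
qed

lemma is_O_diff:
  assumes "is_O S P p f" "is_O S P p h"
  shows "is_O S P p (\<lambda>\<epsilon> z. f \<epsilon> z - h \<epsilon> z)"
  using is_O_add[OF assms(1) is_O_const_scale[OF assms(2), of "-1"]] by simp

lemma is_O_zero: "is_O S P p (\<lambda>\<epsilon> z. 0)"
proof -
  have "is_O S P 0 (\<lambda>\<epsilon> z. 0)" using linear_space_zero[OF linear] by (simp add: is_O_def)
  \<comment> \<open>The factor 0 raises the order of the constant zero family to any
    \<open>p\<close>.\<close>
  from is_O_scale[OF this, of "\<lambda>_. 0" p] show ?thesis by simp
qed

lemma is_O_sum: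
  assumes "\<And>k. k \<in> K \<Longrightarrow> is_O S P p (f k)"
  shows "is_O S P p (\<lambda>\<epsilon> z. \<Sum>k\<in>K. f k \<epsilon> z)"
  using assms by (induction K rule: infinite_finite_induct) (auto intro: is_O_zero is_O_add)

lemma sum_mem: "(\<And>k. k \<in> K \<Longrightarrow> f k \<in> S) \<Longrightarrow> (\<lambda>z. \<Sum>k\<in>K. f k z) \<in> S"
proof (induction K rule: infinite_finite_induct)
  case (insert x K)
  then show ?case using linear_spaceD[OF linear, of "f x" "\<lambda>z. \<Sum>k\<in>K. f k z" 1 1] by auto
qed (simp_all add: linear_space_zero[OF linear])

end

subsection \<open>Directional derivatives\<close>

lemma has_real_derivative_line:
  fixes f :: "'a::real_normed_vector \<Rightarrow> real"
  assumes "f differentiable (at x)"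
  shows "((\<lambda>t. f (x + t *\<^sub>R e)) has_real_derivative frechet_derivative f (at x) e) (at 0)"
proof -
  let ?D = "frechet_derivative f (at x)"
  have D: "(f has_derivative ?D) (at x)" using assms frechet_derivative_works by blast
  have "((\<lambda>t. x + t *\<^sub>R e) has_derivative (\<lambda>t. t *\<^sub>R e)) (at (0::real))"
    by (auto intro!: derivative_eq_intros)
  from has_derivative_compose[OF this, of f ?D]
  have "((\<lambda>t. f (x + t *\<^sub>R e)) has_derivative (\<lambda>t. ?D (t *\<^sub>R e))) (at 0)" using D by simp
  moreover have "?D (t *\<^sub>R e) = ?D e * t" for t
    using linear_scale[OF has_derivative_linear[OF D]] by simp
  ultimately show ?thesis by (simp add: has_field_derivative_def)
qed

text \<open>A sequence of increments replaces the continuous limit, so that only countably many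
  exceptional null sets in the velocity will have to be united.\<close>

lemma pderivative_LIMSEQ:
  assumes "f differentiable (at x)"
  shows "(\<lambda>m. (f (x + (1 / real (Suc m)) *\<^sub>R axis i 1) - f x) / (1 / real (Suc m)))
    \<longlonglongrightarrow> pderivative i f x"
proof -
  have "((\<lambda>h. (f (x + h *\<^sub>R axis i 1) - f x) / h) \<longlongrightarrow> pderivative i f x) (at 0)"
    using has_real_derivative_line[OF assms, of "axis i 1"]
    by (simp add: DERIV_def pderivative_def)
  moreover have "filterlim (\<lambda>m. 1 / real (Suc m)) (at 0) sequentially"
    using LIMSEQ_Suc[OF lim_1_over_n] by (auto simp: filterlim_at simp del: of_nat_Suc)
  ultimately show ?thesis by (rule filterlim_compose)
qed

lemma pderivative_linear:
  assumes "f differentiable (at x)" "h differentiable (at x)"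
  shows "pderivative i (\<lambda>y. a * f y + b * h y) x = a * pderivative i f x + b * pderivative i h x"
proof -
  have f: "(f has_derivative frechet_derivative f (at x)) (at x)"
    and h: "(h has_derivative frechet_derivative h (at x)) (at x)"
    using assms frechet_derivative_works by blast+
  have "((\<lambda>y. a * f y + b * h y) has_derivative
      (\<lambda>t. a * frechet_derivative f (at x) t + b * frechet_derivative h (at x) t)) (at x)"
    by (auto intro!: derivative_eq_intros f h)
  from frechet_derivative_at[OF this] show ?thesis unfolding pderivative_def by metis
qed

lemma transport_eq: "transport f x v = (\<Sum>i\<in>UNIV. v $ i * pderivative i (\<lambda>y. f (y, v)) x)"
  by (simp add: transport_def inner_vec_def grad_def)

subsection \<open>Velocity averages\<close>

context equilibrium
begin

lemma velocity_measurable: "(\<lambda>v. v $ i) \<in> borel_measurable \<mu>"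
proof -
  have "(\<lambda>v::real^'d. v $ i) \<in> borel_measurable (restrict_space borel (space \<mu>))"
    by (intro measurable_restrict_space1) simp
  then show ?thesis using measurable_cong_sets[OF sets_velocity refl] by blast
qed

lemma wL2_measurable: "f \<in> wL2 \<mu> M \<Longrightarrow> f \<in> borel_measurable \<mu>"
  by (simp add: wL2_def)

text \<open>Weighted Cauchy-Schwarz in pointwise form: split \<open>c * f\<close> into
  \<open>c * sqrt M\<close> times \<open>f / sqrt M\<close> and bound the product by the sum of the
  squares.\<close>

lemma wL2_mult_integrable:
  assumes f: "f \<in> wL2 \<mu> M" and c: "c \<in> borel_measurable \<mu>"
    and ci: "integrable \<mu> (\<lambda>v. (c v)\<^sup>2 * M v)"
  shows "integrable \<mu> (\<lambda>v. c v * f v)"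
proof (rule Bochner_Integration.integrable_bound)
  show "integrable \<mu> (\<lambda>v. (c v)\<^sup>2 * M v + (f v)\<^sup>2 / M v)"
    using f ci by (simp add: wL2_def)
  show "(\<lambda>v. c v * f v) \<in> borel_measurable \<mu>"
    using c wL2_measurable[OF f] by simp
  show "AE v in \<mu>. norm (c v * f v) \<le> norm ((c v)\<^sup>2 * M v + (f v)\<^sup>2 / M v)"
  proof (rule AE_I2)
    fix v assume "v \<in> space \<mu>"
    then have m: "0 < M v" by (rule M_pos)
    define p q where "p = \<bar>c v\<bar> * sqrt (M v)" and "q = \<bar>f v\<bar> / sqrt (M v)"
    have "p * q = \<bar>c v * f v\<bar>"
      using m by (simp add: p_def q_def abs_mult)
    moreover have "p\<^sup>2 = (c v)\<^sup>2 * M v" "q\<^sup>2 = (f v)\<^sup>2 / M v"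
      using m by (simp_all add: p_def q_def power_mult_distrib power_divide)
    moreover have "0 \<le> p * q" using m by (simp add: p_def q_def)
    then have "p * q \<le> p\<^sup>2 + q\<^sup>2"
      using sum_squares_bound[of p q] by linarith
    ultimately show "norm (c v * f v) \<le> norm ((c v)\<^sup>2 * M v + (f v)\<^sup>2 / M v)"
      by simp
  qed
qed

lemma wL2_integrable: "f \<in> wL2 \<mu> M \<Longrightarrow> integrable \<mu> f"
  using wL2_mult_integrable[of f "\<lambda>_. 1"] M_integrable by simp

text \<open>The weight required of \<open>v $ i\<close> is a second moment of \<open>M\<close>, and
  \<open>vM_wL2\<close> says that it is finite.\<close>

lemma wL2_velocity_integrable:
  assumes "f \<in> wL2 \<mu> M"
  shows "integrable \<mu> (\<lambda>v. v $ i * f v)"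
proof (rule wL2_mult_integrable[OF assms velocity_measurable])
  have "integrable \<mu> (\<lambda>v. (v $ i * M v)\<^sup>2 / M v)"
    using vM_wL2[of i] by (simp add: wL2_def)
  also have "?this \<longleftrightarrow> integrable \<mu> (\<lambda>v. (v $ i)\<^sup>2 * M v)"
    by (intro Bochner_Integration.integrable_cong refl)
      (auto simp: power_mult_distrib power2_eq_square dest: M_pos)
  finally show "integrable \<mu> (\<lambda>v. (v $ i)\<^sup>2 * M v)" .
qed

lemma M_wL2: "M \<in> wL2 \<mu> M"
proof -
  have "integrable \<mu> (\<lambda>v. (M v)\<^sup>2 / M v) \<longleftrightarrow> integrable \<mu> M"
    by (intro Bochner_Integration.integrable_cong refl) (auto simp: power2_eq_square dest: M_pos)
  then show ?thesis using M_integrable M_measurable by (simp add: wL2_def)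
qed

lemma avg_add: "integrable \<mu> f \<Longrightarrow> integrable \<mu> h \<Longrightarrow> avg \<mu> M (\<lambda>v. f v + h v) = avg \<mu> M f + avg \<mu> M h"
  by (simp add: avg_def add_divide_distrib)

lemma avg_diff: "integrable \<mu> f \<Longrightarrow> integrable \<mu> h \<Longrightarrow> avg \<mu> M (\<lambda>v. f v - h v) = avg \<mu> M f - avg \<mu> M h"
  by (simp add: avg_def diff_divide_distrib)

lemma avg_scale: "avg \<mu> M (\<lambda>v. c * f v) = c * avg \<mu> M f"
  by (simp add: avg_def)

lemma avg_sum: "(\<And>k. k \<in> K \<Longrightarrow> integrable \<mu> (f k)) \<Longrightarrow>
    avg \<mu> M (\<lambda>v. \<Sum>k\<in>K. f k v) = (\<Sum>k\<in>K. avg \<mu> M (f k))"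
  by (simp add: avg_def sum_divide_distrib)

lemma avg_M: "avg \<mu> M M = 1"
  using mass_pos by (simp add: avg_def)

lemma avg_cong_AE:
  "f \<in> borel_measurable \<mu> \<Longrightarrow> h \<in> borel_measurable \<mu> \<Longrightarrow> AE v in \<mu>. f v = h v \<Longrightarrow>
    avg \<mu> M f = avg \<mu> M h"
  unfolding avg_def by (metis integral_cong_AE)

end

section \<open>The collision operator and its pseudo-inverse modulo null sets\<close>

context collision_operator
begin

lemma D_wL2: "f \<in> D \<Longrightarrow> f \<in> wL2 \<mu> M"
  using L_domain by blast

lemma avg_L: "f \<in> D \<Longrightarrow> avg \<mu> M (L f) = 0"
  using L_range[OF L_maps_to] by blast

text \<open>Linearity of \<open>L\<close> speaks of two-term combinations only; the empty sum in
  \<open>L_sum\<close> is covered because zero is \<open>0 * M\<close>, an element of the null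
  space.\<close>

lemma D_zero: "(\<lambda>v. 0) \<in> D" "AE v in \<mu>. L (\<lambda>v. 0) v = 0"
proof -
  have z: "(\<lambda>v. 0) \<in> wL2 \<mu> M" by (simp add: wL2_def)
  have "\<exists>c. AE v in \<mu>. (0::real) = c * M v" by (rule exI[of _ 0]) simp
  then show "(\<lambda>v. 0) \<in> D" "AE v in \<mu>. L (\<lambda>v. 0) v = 0"
    using L_null_space[OF z] by blast+
qed

lemma L_sum:
  assumes "finite K" "\<And>k. k \<in> K \<Longrightarrow> f k \<in> D"
  shows "(\<lambda>v. \<Sum>k\<in>K. c k * f k v) \<in> D \<and>
    (AE v in \<mu>. L (\<lambda>w. \<Sum>k\<in>K. c k * f k w) v = (\<Sum>k\<in>K. c k * L (f k) v))"
  using assms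
proof (induction K rule: finite_induct)
  case empty
  then show ?case using D_zero by simp
next
  case (insert x K)
  then have IH: "(\<lambda>v. \<Sum>k\<in>K. c k * f k v) \<in> D"
    "AE v in \<mu>. L (\<lambda>w. \<Sum>k\<in>K. c k * f k w) v = (\<Sum>k\<in>K. c k * L (f k) v)" and x: "f x \<in> D" by auto
  note lin = L_linear[OF x IH(1), of "c x" 1]
  have "AE v in \<mu>. L (\<lambda>w. c x * f x w + (\<Sum>k\<in>K. c k * f k w)) v
      = c x * L (f x) v + (\<Sum>k\<in>K. c k * L (f k) v)"
    using lin[THEN conjunct2] IH(2) by eventually_elim simp
  then show ?case using lin insert.hyps by simp
qed

lemma M_mem: "M \<in> D" "AE v in \<mu>. L M v = 0"
proof -
  have "\<exists>c. AE v in \<mu>. M v = c * M v" by (rule exI[of _ 1]) simp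
  then show "M \<in> D" "AE v in \<mu>. L M v = 0"
    using L_null_space[OF M_wL2] by blast+
qed

text \<open>Justifies the choice in the definition: subtracting \<open>avg \<mu> M h * M\<close>
  from any preimage \<open>h\<close> removes its average and leaves its image unchanged, since
  \<open>M\<close> spans the null space.\<close>

lemma pseudo_inverse:
  assumes "f \<in> wL2 \<mu> M" "avg \<mu> M f = 0"
  shows "is_inverse_image \<mu> M D L f (pseudo_inverse \<mu> M D L f)"
proof -
  obtain h where h: "h \<in> D" "AE v in \<mu>. L h v = f v" using L_range assms by blast
  let ?h = "\<lambda>v. 1 * h v + (- avg \<mu> M h) * M v"
  note lin = L_linear[OF h(1) M_mem(1), of 1 "- avg \<mu> M h"]
  have "AE v in \<mu>. L ?h v = f v"
    using lin[THEN conjunct2] h(2) M_mem(2) by eventually_elim simp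
  moreover have "avg \<mu> M ?h = 0"
    using wL2_integrable[OF D_wL2[OF h(1)]] M_integrable
    by (simp add: avg_diff avg_scale avg_M)
  ultimately have "is_inverse_image \<mu> M D L f ?h" using lin by (simp add: is_inverse_image_def)
  then show ?thesis unfolding pseudo_inverse_def by (rule someI[where P = "is_inverse_image \<mu> M D L f"])
qed

text \<open>The difference of two solutions is a multiple of \<open>M\<close>, and its vanishing
  average forces the multiple to be zero.\<close>

lemma inverse_image_unique:
  assumes f: "is_inverse_image \<mu> M D L r f" and h: "is_inverse_image \<mu> M D L r h"
  shows "AE v in \<mu>. f v = h v"
proof -
  have D: "f \<in> D" "h \<in> D" and z: "avg \<mu> M f = 0" "avg \<mu> M h = 0"
    and Lf: "AE v in \<mu>. L f v = r v" and Lh: "AE v in \<mu>. L h v = r v"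
    using f h by (simp_all add: is_inverse_image_def)
  let ?d = "\<lambda>v. 1 * f v + (-1) * h v"
  note lin = L_linear[OF D, of 1 "-1"]
  have "AE v in \<mu>. L ?d v = 0"
    using lin[THEN conjunct2] Lf Lh by eventually_elim simp
  then obtain c where c: "AE v in \<mu>. ?d v = c * M v"
    using lin L_null_space[OF D_wL2, of ?d] by blast
  have int: "integrable \<mu> f" "integrable \<mu> h" using D by (auto intro: wL2_integrable D_wL2)
  have "avg \<mu> M ?d = avg \<mu> M (\<lambda>v. c * M v)"
    by (rule avg_cong_AE[OF _ _ c]) (use int M_measurable in \<open>auto dest: borel_measurable_integrable\<close>)
  moreover have "avg \<mu> M ?d = 0" using int z by (simp add: avg_diff)
  ultimately have "c = 0" by (simp add: avg_scale avg_M)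
  then show ?thesis using c by simp
qed

end

subsection \<open>The transport and drift operators of the micro equation\<close>

text \<open>The operator \<open>(I - Pi)(v . grad)\<close> of the micro equation, written on pairs
  so that it maps \<open>G\<close> to itself and \<open>O_stable\<close> applies to it. The same
  holds for \<open>drift\<close>, from \<open>R\<close> to \<open>G\<close>.\<close>

definition micro_transport :: "(real^'d::finite) measure \<Rightarrow> (real^'d \<Rightarrow> real) \<Rightarrow>
    ((real^'d) \<times> (real^'d) \<Rightarrow> real) \<Rightarrow> (real^'d) \<times> (real^'d) \<Rightarrow> real" where
  "micro_transport \<mu> M f = (\<lambda>(x, v). transport f x v - Proj \<mu> M (transport f x) v)"

definition drift :: "(real^'d \<Rightarrow> real) \<Rightarrow> (real^'d \<Rightarrow> real) \<Rightarrow> (real^'d) \<times> (real^'d::finite) \<Rightarrow> real" where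
  "drift M r = (\<lambda>(x, v). inner (M v *\<^sub>R v) (grad r x))"

lemma drift_eq: "drift M r (x, v) = (\<Sum>i\<in>UNIV. v $ i * (pderivative i r x * M v))"
  by (simp add: drift_def inner_vec_def grad_def mult_ac)

sublocale asymptotic_setting \<subseteq> macro: seminormed_space R PR
  using R_linear R_seminorms by unfold_locales

sublocale asymptotic_setting \<subseteq> micro: seminormed_space G PG
  using G_linear G_seminorms by unfold_locales

context asymptotic_setting
begin

lemma transport_O_stable: "O_stable G PG G PG (\<lambda>f (x, v). transport f x v)"
  unfolding O_stable_def
proof (intro allI impI)
  fix p f assume f: "is_O G PG p f"
  \<comment> \<open>The term is spelled out, with its seemingly redundant \<open>case\<close>, as a
    literal composition of the stable operators, so that \<open>is_O_stable\<close> can be applied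
    to each layer. The next proofs do the same.\<close>
  have "is_O G PG p (\<lambda>\<epsilon> z. \<Sum>i\<in>UNIV. (\<lambda>(x, v). v $ i * (case (x, v) of (x, v) \<Rightarrow> pderivative i (\<lambda>y. f \<epsilon> (y, v)) x)) z)"
    by (intro micro.is_O_sum is_O_stable[OF stable_velocity] is_O_stable[OF stable_derivative_G] f)
  then show "is_O G PG p (\<lambda>\<epsilon> (x, v). transport (f \<epsilon>) x v)"
    by (simp add: transport_eq split_def)
qed

lemma micro_transport_O_stable: "O_stable G PG G PG (micro_transport \<mu> M)"
  unfolding O_stable_def
proof (intro allI impI)
  fix p f assume f: "is_O G PG p f"
  note t = is_O_stable[OF transport_O_stable f]
  have "is_O G PG p (\<lambda>\<epsilon> z. (\<lambda>(x, v). transport (f \<epsilon>) x v) z -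
      (\<lambda>(x, v). avg \<mu> M (\<lambda>v. case (x, v) of (x, v) \<Rightarrow> transport (f \<epsilon>) x v) * M v) z)"
    by (intro micro.is_O_diff t is_O_stable[OF stable_equilibrium] is_O_stable[OF stable_average])
  then show "is_O G PG p (\<lambda>\<epsilon>. micro_transport \<mu> M (f \<epsilon>))"
    by (simp add: micro_transport_def Proj_def split_def)
qed

lemma drift_O_stable: "O_stable R PR G PG (drift M)"
  unfolding O_stable_def
proof (intro allI impI)
  fix p r assume r: "is_O R PR p r"
  have "is_O G PG p (\<lambda>\<epsilon> z. \<Sum>i\<in>UNIV. (\<lambda>(x, v). v $ i * (case (x, v) of (x, v) \<Rightarrow> pderivative i (r \<epsilon>) x * M v)) z)"
    by (intro micro.is_O_sum is_O_stable[OF stable_velocity] is_O_stable[OF stable_equilibrium]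
        is_O_stable[OF stable_derivative_R] r)
  moreover have "drift M (r \<epsilon>) = (\<lambda>z. \<Sum>i\<in>UNIV. (\<lambda>(x, v). v $ i * (case (x, v) of (x, v) \<Rightarrow> pderivative i (r \<epsilon>) x * M v)) z)" for \<epsilon>
    by (auto simp: drift_eq)
  ultimately show "is_O G PG p (\<lambda>\<epsilon>. drift M (r \<epsilon>))" by simp
qed

lemma flux_component_O_stable: "O_stable G PG R PR (\<lambda>f x. flux \<mu> M f x $ i)"
  unfolding O_stable_def
proof (intro allI impI)
  fix p f assume f: "is_O G PG p f"
  show "is_O R PR p (\<lambda>\<epsilon> x. flux \<mu> M (f \<epsilon>) x $ i)"
    using is_O_stable[OF stable_average is_O_stable[OF stable_velocity f]] by (simp add: flux_def)
qed

lemma divergence_flux_O_stable: "O_stable G PG R PR (\<lambda>f x. divergence (flux \<mu> M f) x)"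
  unfolding O_stable_def divergence_def
  by (intro allI impI macro.is_O_sum is_O_stable[OF stable_derivative_R]
      is_O_stable[OF flux_component_O_stable])

section \<open>Vanishing averages, and invariance under changes on null sets\<close>

lemma G_integrable: "f \<in> G \<Longrightarrow> integrable \<mu> (\<lambda>v. f (x, v))"
  by (rule wL2_integrable[OF G_wL2])

text \<open>Since \<open>M\<close> has average 1, \<open>I - Pi\<close> removes the average. With
  \<open>avg_drift\<close> and \<open>avg_L\<close> this makes every increment of the micro equation
  mean free.\<close>

lemma avg_micro_transport:
  assumes "f \<in> G"
  shows "avg \<mu> M (\<lambda>v. micro_transport \<mu> M f (x, v)) = 0"
proof -
  have "integrable \<mu> (transport f x)"
    using G_integrable[OF O_stable_maps[OF transport_O_stable assms], of x] by simp
  then show ?thesis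
    using M_integrable by (simp add: micro_transport_def Proj_def avg_diff avg_scale avg_M)
qed

lemma avg_drift: "avg \<mu> M (\<lambda>v. drift M r (x, v)) = 0"
proof -
  have *: "drift M r (x, v) = (\<Sum>i\<in>UNIV. pderivative i r x * (v $ i * M v))" for v
    by (simp add: drift_eq mult_ac)
  have "integrable \<mu> (\<lambda>v. v $ i * M v)" for i by (rule wL2_integrable[OF vM_wL2])
  then show ?thesis unfolding * by (simp add: avg_sum avg_scale vM_avg)
qed

text \<open>The null set may depend on \<open>x\<close>, so the difference quotients are compared along the
  sequence \<open>x + e\<^sub>i / m\<close>.\<close>

lemma pderivative_cong_AE:
  assumes f: "f \<in> G" and h: "h \<in> G" and eq: "\<And>x. AE v in \<mu>. f (x, v) = h (x, v)"
  shows "AE v in \<mu>. pderivative i (\<lambda>y. f (y, v)) x = pderivative i (\<lambda>y. h (y, v)) x"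
proof -
  let ?x = "\<lambda>m. x + (1 / real (Suc m)) *\<^sub>R axis i 1"
  have "AE v in \<mu>. \<forall>m. f (?x m, v) = h (?x m, v)" using eq by (simp add: AE_all_countable)
  then show ?thesis using eq[of x] AE_space
  proof eventually_elim
    case (elim v)
    have "(\<lambda>y. f (y, v)) differentiable (at x)" "(\<lambda>y. h (y, v)) differentiable (at x)"
      using G_functions f h elim(3) by blast+
    note lim = this[THEN pderivative_LIMSEQ, of i]
    from lim(2) have "(\<lambda>m. (f (?x m, v) - f (x, v)) / (1 / real (Suc m)))
        \<longlonglongrightarrow> pderivative i (\<lambda>y. h (y, v)) x"
      using elim(1,2) by simp
    with lim(1) show ?case by (rule LIMSEQ_unique)
  qed
qed

text \<open>Needed for a first stage without implicit part, which equals the initial datum of the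
  step only almost everywhere in \<open>v\<close>.\<close>

lemma micro_transport_cong_AE:
  assumes f: "f \<in> G" and h: "h \<in> G" and eq: "\<And>x. AE v in \<mu>. f (x, v) = h (x, v)"
  shows "AE v in \<mu>. micro_transport \<mu> M f (x, v) = micro_transport \<mu> M h (x, v)"
proof -
  have "AE v in \<mu>. \<forall>i\<in>UNIV. pderivative i (\<lambda>y. f (y, v)) x = pderivative i (\<lambda>y. h (y, v)) x"
    by (intro AE_finite_allI) (simp_all add: pderivative_cong_AE[OF f h eq])
  then have t: "AE v in \<mu>. transport f x v = transport h x v"
    by eventually_elim (simp add: transport_eq)
  have "avg \<mu> M (transport f x) = avg \<mu> M (transport h x)"
    using G_integrable[OF O_stable_maps[OF transport_O_stable f], of x]
      G_integrable[OF O_stable_maps[OF transport_O_stable h], of x]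
    by (intro avg_cong_AE t) auto
  with t show ?thesis by (auto simp: micro_transport_def Proj_def elim: eventually_mono)
qed

end

subsection \<open>The fluxes of the limit\<close>

context asymptotic_setting
begin

abbreviation "\<kappa> \<equiv> diffusion_matrix \<mu> M D L"

lemma diffusive_flux_mem: "r \<in> R \<Longrightarrow> (\<lambda>y. (\<kappa> *v grad r y) $ i) \<in> R"
proof -
  assume r: "r \<in> R"
  have "(\<lambda>y. \<Sum>k\<in>UNIV. \<kappa> $ i $ k * pderivative k r y) \<in> R"
    by (intro macro.sum_mem linear_space_scale[OF R_linear] O_stable_maps[OF stable_derivative_R] r)
  then show ?thesis by (simp add: matrix_vector_mult_def grad_def)
qed

text \<open>With \<open>\<phi> k\<close> the pseudo-inverse of \<open>v $ k * M\<close>, the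
  combination \<open>u\<close> of the \<open>\<phi> k\<close> with coefficients
  \<open>e * pderivative k r x\<close> solves \<open>L u = e * drift\<close>. Uniqueness gives
  \<open>f = w + u\<close> almost everywhere, and the flux of \<open>u\<close> is the diffusive one
  by definition of \<open>\<kappa>\<close>. All this happens at a fixed \<open>x\<close>, so
  \<open>u\<close> need not be smooth in position.\<close>

lemma flux_of_drift_solution:
  assumes f: "f \<in> G" "\<And>x. (\<lambda>v. f (x, v)) \<in> D" "\<And>x. avg \<mu> M (\<lambda>v. f (x, v)) = 0"
    and w: "w \<in> G" "\<And>x. is_inverse_image \<mu> M D L (\<lambda>v. q (x, v)) (\<lambda>v. w (x, v))"
    and Lf: "\<And>x. AE v in \<mu>. L (\<lambda>v. f (x, v)) v = q (x, v) + e * drift M r (x, v)"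
  shows "flux \<mu> M f x $ i = flux \<mu> M w x $ i - e * (\<kappa> *v grad r x) $ i"
proof -
  define \<phi> where "\<phi> k = pseudo_inverse \<mu> M D L (\<lambda>v. v $ k * M v)" for k
  have \<phi>: "\<phi> k \<in> D" "avg \<mu> M (\<phi> k) = 0" "AE v in \<mu>. L (\<phi> k) v = v $ k * M v" for k
    using pseudo_inverse[OF vM_wL2[of k] vM_avg[of k]] by (simp_all add: is_inverse_image_def \<phi>_def)
  have \<phi>_int: "integrable \<mu> (\<phi> k)" "integrable \<mu> (\<lambda>v. v $ i * \<phi> k v)" for k
    using \<phi>(1) by (simp_all add: wL2_integrable wL2_velocity_integrable D_wL2)
  define c where "c k = e * pderivative k r x" for k
  define u where "u v = (\<Sum>k\<in>UNIV. c k * \<phi> k v)" for v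
  have u: "u \<in> D" "AE v in \<mu>. L u v = (\<Sum>k\<in>UNIV. c k * L (\<phi> k) v)"
    using L_sum[of UNIV \<phi> c] \<phi>(1) unfolding u_def by auto
  have "AE v in \<mu>. \<forall>k\<in>UNIV. L (\<phi> k) v = v $ k * M v"
    by (intro AE_finite_allI) (simp_all add: \<phi>)
  with u(2) have Lu: "AE v in \<mu>. L u v = e * drift M r (x, v)"
    by eventually_elim (simp add: c_def drift_eq sum_distrib_left mult_ac)
  have u_avg: "avg \<mu> M u = 0"
    unfolding u_def using \<phi>_int by (simp add: avg_sum avg_scale \<phi>)
  have wD: "(\<lambda>v. w (x, v)) \<in> D" "avg \<mu> M (\<lambda>v. w (x, v)) = 0"
    "AE v in \<mu>. L (\<lambda>v. w (x, v)) v = q (x, v)"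
    using w(2)[of x] by (simp_all add: is_inverse_image_def)
  have u_int: "integrable \<mu> u" "integrable \<mu> (\<lambda>v. v $ i * u v)"
    using u(1) by (simp_all add: wL2_integrable wL2_velocity_integrable D_wL2)
  have w_int: "integrable \<mu> (\<lambda>v. w (x, v))" "integrable \<mu> (\<lambda>v. v $ i * w (x, v))"
    using w(1) by (simp_all add: wL2_integrable wL2_velocity_integrable G_wL2)
  note lin = L_linear[OF wD(1) u(1), of 1 1]
  have "AE v in \<mu>. L (\<lambda>v. 1 * w (x, v) + 1 * u v) v = q (x, v) + e * drift M r (x, v)"
    using lin[THEN conjunct2] wD(3) Lu by eventually_elim simp
  then have "is_inverse_image \<mu> M D L (\<lambda>v. q (x, v) + e * drift M r (x, v)) (\<lambda>v. w (x, v) + u v)"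
    using lin w_int u_int by (simp add: is_inverse_image_def avg_add wD u_avg)
  moreover have "is_inverse_image \<mu> M D L (\<lambda>v. q (x, v) + e * drift M r (x, v)) (\<lambda>v. f (x, v))"
    using f Lf[of x] by (simp add: is_inverse_image_def)
  ultimately have ae: "AE v in \<mu>. w (x, v) + u v = f (x, v)"
    by (rule inverse_image_unique)
  have "avg \<mu> M (\<lambda>v. v $ i * f (x, v)) = avg \<mu> M (\<lambda>v. v $ i * w (x, v) + v $ i * u v)"
  proof (rule avg_cong_AE)
    show "AE v in \<mu>. v $ i * f (x, v) = v $ i * w (x, v) + v $ i * u v"
      using ae by eventually_elim (simp flip: distrib_left)
    show "(\<lambda>v. v $ i * f (x, v)) \<in> borel_measurable \<mu>"
      using wL2_velocity_integrable[OF G_wL2[OF f(1)]] by blast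
    show "(\<lambda>v. v $ i * w (x, v) + v $ i * u v) \<in> borel_measurable \<mu>"
      using w_int u_int by (intro borel_measurable_integrable) simp
  qed
  also have "\<dots> = avg \<mu> M (\<lambda>v. v $ i * w (x, v)) + avg \<mu> M (\<lambda>v. v $ i * u v)"
    using w_int u_int by (simp add: avg_add)
  also have "avg \<mu> M (\<lambda>v. v $ i * u v) = avg \<mu> M (\<lambda>v. \<Sum>k\<in>UNIV. c k * (v $ i * \<phi> k v))"
    by (simp add: u_def sum_distrib_left mult_ac)
  also have "\<dots> = (\<Sum>k\<in>UNIV. c k * avg \<mu> M (\<lambda>v. v $ i * \<phi> k v))"
    using \<phi>_int by (simp add: avg_sum avg_scale)
  also have "\<dots> = - (e * (\<kappa> *v grad r x) $ i)"
    by (simp add: matrix_vector_mult_def diffusion_matrix_def grad_def \<phi>_def c_def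
        sum_distrib_left mult_ac flip: sum_negf)
  finally show ?thesis by (simp add: flux_def)
qed

text \<open>The two fluxes on the right have components in \<open>R\<close>, hence differentiable
  ones, so the pointwise identity of fluxes may be differentiated term by term.\<close>

lemma divergence_flux_of_drift_solution:
  assumes "f \<in> G" "\<And>x. (\<lambda>v. f (x, v)) \<in> D" "\<And>x. avg \<mu> M (\<lambda>v. f (x, v)) = 0"
    and w: "w \<in> G" "\<And>x. is_inverse_image \<mu> M D L (\<lambda>v. q (x, v)) (\<lambda>v. w (x, v))"
    and "\<And>x. AE v in \<mu>. L (\<lambda>v. f (x, v)) v = q (x, v) + e * drift M r (x, v)"
    and r: "r \<in> R"
  shows "divergence (flux \<mu> M f) x
    = divergence (flux \<mu> M w) x - e * divergence (\<lambda>y. \<kappa> *v grad r y) x"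
proof -
  have "pderivative i (\<lambda>y. flux \<mu> M f y $ i) x =
      pderivative i (\<lambda>y. flux \<mu> M w y $ i) x - e * pderivative i (\<lambda>y. (\<kappa> *v grad r y) $ i) x" for i
  proof -
    have "(\<lambda>y. flux \<mu> M w y $ i) \<in> R" "(\<lambda>y. (\<kappa> *v grad r y) $ i) \<in> R"
      using O_stable_maps[OF flux_component_O_stable w(1)] diffusive_flux_mem[OF r] by auto
    then have "(\<lambda>y. flux \<mu> M w y $ i) differentiable (at x)"
      "(\<lambda>y. (\<kappa> *v grad r y) $ i) differentiable (at x)" using R_functions by blast+
    from pderivative_linear[OF this, of i 1 "- e"] show ?thesis
      using flux_of_drift_solution[of f w q e r] assms by simp
  qed
  then show ?thesis by (simp add: divergence_def sum_subtractf sum_distrib_left)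
qed

end

subsection \<open>Estimates for one step\<close>

text \<open>\<open>degenerate_stage\<close> is what type A and type CK-ARS have in common: a stage without implicit
  part can only be the first one, and it does not enter the implicit part of any stage.\<close>

locale imex_asymptotics = asymptotic_setting \<mu> M D L lo hi R PR G PG + imex_method s At A
  for \<mu> :: "(real^'d::finite) measure" and M D L lo hi R PR G PG s At A +
  fixes dt :: real
  assumes dt: "0 < dt"
    and stable_resolvent: "\<And>j. j < s \<Longrightarrow> A $$ (j, j) \<noteq> 0 \<Longrightarrow>
        inverse_O_stable \<mu> M D G PG (\<lambda>\<epsilon> h v. \<epsilon>\<^sup>2 * h v - A $$ (j, j) * dt * L h v)"
    and degenerate_stage: "\<And>k j. k < s \<Longrightarrow> j < s \<Longrightarrow> A $$ (k, k) = 0 \<Longrightarrow> k = 0 \<and> A $$ (j, k) = 0"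
begin

lemma stage_equation:
  assumes "imex_step \<mu> M D L s At A dt e rn gn rs gs rn' gn'" "j < s"
  shows "AE v in \<mu>. gs j (x, v) = gn (x, v)
    - (\<Sum>k<j. At $$ (j, k) * (dt / e) * micro_transport \<mu> M (gs k) (x, v))
    - (\<Sum>k\<le>j. A $$ (j, k) * (dt / e) * drift M (rs k) (x, v))
    + (\<Sum>k\<le>j. A $$ (j, k) * (dt / e\<^sup>2) * L (\<lambda>w. gs k (x, w)) v)"
  using assms by (simp add: imex_step_def micro_transport_def drift_def)

lemma stage_mem_D:
  "imex_step \<mu> M D L s At A dt e rn gn rs gs rn' gn' \<Longrightarrow> j < s \<Longrightarrow> (\<lambda>v. gs j (x, v)) \<in> D"
  by (simp add: imex_step_def)

text \<open>No induction over stages is needed: the transport, drift and collision terms have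
  average zero whatever the averages of the stages in them, so only the average of \<open>gn\<close>
  survives.\<close>

lemma stage_average_zero:
  assumes step: "imex_step \<mu> M D L s At A dt e rn gn rs gs rn' gn'" and j: "j < s"
    and gn: "gn \<in> G" "\<And>x. avg \<mu> M (\<lambda>v. gn (x, v)) = 0"
    and gs: "\<And>k. k < s \<Longrightarrow> gs k \<in> G" and rs: "\<And>k. k < s \<Longrightarrow> rs k \<in> R"
  shows "avg \<mu> M (\<lambda>v. gs j (x, v)) = 0"
proof -
  have T: "integrable \<mu> (\<lambda>v. micro_transport \<mu> M (gs k) (x, v))"
    "avg \<mu> M (\<lambda>v. micro_transport \<mu> M (gs k) (x, v)) = 0" if "k < j" for k
    using that j gs[of k] O_stable_maps[OF micro_transport_O_stable]
    by (auto intro: G_integrable avg_micro_transport)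
  have d: "integrable \<mu> (\<lambda>v. drift M (rs k) (x, v))" if "k \<le> j" for k
    using that j rs[of k] O_stable_maps[OF drift_O_stable] by (auto intro: G_integrable)
  have L: "integrable \<mu> (L (\<lambda>v. gs k (x, v)))" "avg \<mu> M (L (\<lambda>v. gs k (x, v))) = 0" if "k \<le> j" for k
    using that j stage_mem_D[OF step, of k x] by (auto intro: wL2_integrable L_maps_to avg_L)
  note int_gn = G_integrable[OF gn(1), of x]
  have int_T: "integrable \<mu> (\<lambda>v. \<Sum>k<j. At $$ (j, k) * (dt / e) * micro_transport \<mu> M (gs k) (x, v))"
    by (intro Bochner_Integration.integrable_sum integrable_mult_right T) simp
  have int_d: "integrable \<mu> (\<lambda>v. \<Sum>k\<le>j. A $$ (j, k) * (dt / e) * drift M (rs k) (x, v))"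
    by (intro Bochner_Integration.integrable_sum integrable_mult_right d) simp
  have int_L: "integrable \<mu> (\<lambda>v. \<Sum>k\<le>j. A $$ (j, k) * (dt / e\<^sup>2) * L (\<lambda>w. gs k (x, w)) v)"
    by (intro Bochner_Integration.integrable_sum integrable_mult_right L) simp
  have "avg \<mu> M (\<lambda>v. gs j (x, v)) = avg \<mu> M (\<lambda>v. gn (x, v)
    - (\<Sum>k<j. At $$ (j, k) * (dt / e) * micro_transport \<mu> M (gs k) (x, v))
    - (\<Sum>k\<le>j. A $$ (j, k) * (dt / e) * drift M (rs k) (x, v))
    + (\<Sum>k\<le>j. A $$ (j, k) * (dt / e\<^sup>2) * L (\<lambda>w. gs k (x, w)) v))"
  proof (rule avg_cong_AE[OF _ _ stage_equation[OF step j]])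
    show "(\<lambda>v. gs j (x, v)) \<in> borel_measurable \<mu>"
      using G_integrable[OF gs[OF j]] by blast
  qed (intro borel_measurable_integrable Bochner_Integration.integrable_add
      Bochner_Integration.integrable_diff int_gn int_T int_d int_L)
  also have "\<dots> = avg \<mu> M (\<lambda>v. gn (x, v))
    - avg \<mu> M (\<lambda>v. \<Sum>k<j. At $$ (j, k) * (dt / e) * micro_transport \<mu> M (gs k) (x, v))
    - avg \<mu> M (\<lambda>v. \<Sum>k\<le>j. A $$ (j, k) * (dt / e) * drift M (rs k) (x, v))
    + avg \<mu> M (\<lambda>v. \<Sum>k\<le>j. A $$ (j, k) * (dt / e\<^sup>2) * L (\<lambda>w. gs k (x, w)) v)"
    by (subst avg_add avg_diff; (intro Bochner_Integration.integrable_diff int_gn int_T int_d int_L)?)+ simp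
  also have "avg \<mu> M (\<lambda>v. \<Sum>k<j. At $$ (j, k) * (dt / e) * micro_transport \<mu> M (gs k) (x, v)) = 0"
    by (subst avg_sum; (intro sum.neutral ballI)?; simp only: avg_scale integrable_mult_right T lessThan_iff mult_zero_right)
  also have "avg \<mu> M (\<lambda>v. \<Sum>k\<le>j. A $$ (j, k) * (dt / e) * drift M (rs k) (x, v)) = 0"
    by (subst avg_sum; (intro sum.neutral ballI)?; simp only: avg_scale integrable_mult_right d atMost_iff avg_drift mult_zero_right)
  also have "avg \<mu> M (\<lambda>v. \<Sum>k\<le>j. A $$ (j, k) * (dt / e\<^sup>2) * L (\<lambda>w. gs k (x, w)) v) = 0"
    by (subst avg_sum; (intro sum.neutral ballI)?; simp only: avg_scale integrable_mult_right L atMost_iff mult_zero_right)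
  also have "avg \<mu> M (\<lambda>v. gn (x, v)) = 0" by (rule gn(2))
  finally have "avg \<mu> M (\<lambda>v. gs j (x, v)) = 0 - 0 - 0 + 0" .
  then show ?thesis by simp
qed

text \<open>The stage equation times \<open>e\<^sup>2\<close>, with the collision terms of earlier
  stages eliminated through \<open>q\<close>. Their drift parts cancel exactly against the drift
  terms of the same stages; this is why only the remainders \<open>q k\<close> and the drift of
  stage \<open>j\<close> are left.\<close>

lemma stage_resolvent:
  assumes step: "imex_step \<mu> M D L s At A dt e rn gn rs gs rn' gn'" and j: "j < s" and e: "0 < e"
    and T: "\<And>k. k < j \<Longrightarrow>
      AE v in \<mu>. micro_transport \<mu> M (gs k) (x, v) = micro_transport \<mu> M (gh k) (x, v)"
    and q: "\<And>k. k < j \<Longrightarrow> A $$ (j, k) \<noteq> 0 \<Longrightarrow>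
      AE v in \<mu>. L (\<lambda>v. gs k (x, v)) v = q k (x, v) + e * drift M (rs k) (x, v)"
  shows "AE v in \<mu>. e\<^sup>2 * gs j (x, v) - A $$ (j, j) * dt * L (\<lambda>v. gs j (x, v)) v
    = e\<^sup>2 * gn (x, v) - e * (\<Sum>k<j. dt * At $$ (j, k) * micro_transport \<mu> M (gh k) (x, v))
      + (\<Sum>k<j. dt * A $$ (j, k) * q k (x, v)) - A $$ (j, j) * dt * (e * drift M (rs j) (x, v))"
proof -
  have "AE v in \<mu>. \<forall>k\<in>{..<j}.
      micro_transport \<mu> M (gs k) (x, v) = micro_transport \<mu> M (gh k) (x, v)"
    using T by (intro AE_finite_allI) auto
  \<comment> \<open>The factor \<open>A $$ (j, k)\<close> stays in the claim because nothing is
    known about \<open>L\<close> on stages whose coefficient vanishes.\<close>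
  moreover have "AE v in \<mu>. \<forall>k\<in>{..<j}. A $$ (j, k) * L (\<lambda>v. gs k (x, v)) v
      = A $$ (j, k) * (q k (x, v) + e * drift M (rs k) (x, v))"
  proof (intro AE_finite_allI)
    fix k assume "k \<in> {..<j}"
    then show "AE v in \<mu>. A $$ (j, k) * L (\<lambda>v. gs k (x, v)) v
        = A $$ (j, k) * (q k (x, v) + e * drift M (rs k) (x, v))"
      using q[of k] by (cases "A $$ (j, k) = 0") auto
  qed simp
  ultimately show ?thesis using stage_equation[OF step j, of x]
  proof eventually_elim
    case (elim v)
    define ST where "ST = (\<Sum>k<j. At $$ (j, k) * micro_transport \<mu> M (gh k) (x, v))"
    define Sd where "Sd = (\<Sum>k<j. A $$ (j, k) * drift M (rs k) (x, v))"
    define Sq where "Sq = (\<Sum>k<j. A $$ (j, k) * q k (x, v))"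
    have T: "(\<Sum>k<j. At $$ (j, k) * (dt / e) * micro_transport \<mu> M (gs k) (x, v)) = dt / e * ST"
      using elim(1) by (simp add: ST_def sum_distrib_left mult_ac)
    have d: "(\<Sum>k\<le>j. A $$ (j, k) * (dt / e) * drift M (rs k) (x, v))
        = dt / e * (Sd + A $$ (j, j) * drift M (rs j) (x, v))"
      by (simp add: Sd_def sum_distrib_left distrib_left mult_ac flip: lessThan_Suc_atMost)
    have "(\<Sum>k<j. A $$ (j, k) * L (\<lambda>v. gs k (x, v)) v)
        = (\<Sum>k<j. A $$ (j, k) * (q k (x, v) + e * drift M (rs k) (x, v)))"
      using elim(2) by (intro sum.cong) auto
    also have "\<dots> = Sq + e * Sd"
      by (simp add: Sq_def Sd_def sum_distrib_left distrib_left sum.distrib mult_ac)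
    finally have "(\<Sum>k\<le>j. A $$ (j, k) * L (\<lambda>v. gs k (x, v)) v)
        = Sq + e * Sd + A $$ (j, j) * L (\<lambda>v. gs j (x, v)) v"
      by (simp flip: lessThan_Suc_atMost)
    moreover have "(\<Sum>k\<le>j. A $$ (j, k) * (dt / e\<^sup>2) * L (\<lambda>v. gs k (x, v)) v)
        = dt / e\<^sup>2 * (\<Sum>k\<le>j. A $$ (j, k) * L (\<lambda>v. gs k (x, v)) v)"
      by (simp add: sum_distrib_left mult_ac)
    ultimately have L: "(\<Sum>k\<le>j. A $$ (j, k) * (dt / e\<^sup>2) * L (\<lambda>v. gs k (x, v)) v)
        = dt / e\<^sup>2 * (Sq + e * Sd + A $$ (j, j) * L (\<lambda>v. gs j (x, v)) v)"
      by simp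
    have "e\<^sup>2 * gs j (x, v) = e\<^sup>2 * gn (x, v) - e * dt * ST - A $$ (j, j) * dt * (e * drift M (rs j) (x, v))
        + dt * Sq + A $$ (j, j) * dt * L (\<lambda>v. gs j (x, v)) v"
      using e unfolding elim(3) T d L by (simp add: field_simps power2_eq_square)
    then show ?case by (simp add: ST_def Sq_def sum_distrib_left mult_ac)
  qed
qed

end

text \<open>The second conclusion bounds a solution already at hand, as the stages are for the
  resolvent; the first provides one, as needed for the pseudo-inverse of \<open>L\<close>.\<close>

lemma inverse_O_stableD:
  assumes "inverse_O_stable \<mu> M D G PG T" "is_O G PG p f"
    and "\<forall>\<^sub>F \<epsilon> in at_right 0. \<forall>x. avg \<mu> M (\<lambda>v. f \<epsilon> (x, v)) = 0"
  shows "\<exists>h. \<forall>\<^sub>F \<epsilon> in at_right 0. h \<epsilon> \<in> G \<and>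
      (\<forall>x. is_inverse_image \<mu> M D (T \<epsilon>) (\<lambda>v. f \<epsilon> (x, v)) (\<lambda>v. h \<epsilon> (x, v)))"
    and "\<forall>\<^sub>F \<epsilon> in at_right 0. h \<epsilon> \<in> G \<and>
      (\<forall>x. is_inverse_image \<mu> M D (T \<epsilon>) (\<lambda>v. f \<epsilon> (x, v)) (\<lambda>v. h \<epsilon> (x, v))) \<Longrightarrow> is_O G PG p h"
  using assms(1)[unfolded inverse_O_stable_def Let_def, rule_format, OF conjI, OF assms(2,3)]
  by blast+

section \<open>Families of steps as \<epsilon> tends to zero\<close>

context imex_asymptotics
begin

text \<open>The assumption \<open>gn_prepared\<close> treats both types of tableau at once: data of
  order \<epsilon> are required only if the first stage has no implicit part.\<close>

context
  fixes rn :: "real \<Rightarrow> real^'d \<Rightarrow> real" and gn :: "real \<Rightarrow> (real^'d) \<times> (real^'d) \<Rightarrow> real"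
    and rs :: "real \<Rightarrow> nat \<Rightarrow> real^'d \<Rightarrow> real" and gs :: "real \<Rightarrow> nat \<Rightarrow> (real^'d) \<times> (real^'d) \<Rightarrow> real"
    and rn' :: "real \<Rightarrow> real^'d \<Rightarrow> real" and gn' :: "real \<Rightarrow> (real^'d) \<times> (real^'d) \<Rightarrow> real"
  assumes step: "\<forall>\<^sub>F \<epsilon> in at_right 0.
        imex_step \<mu> M D L s At A dt \<epsilon> (rn \<epsilon>) (gn \<epsilon>) (rs \<epsilon>) (gs \<epsilon>) (rn' \<epsilon>) (gn' \<epsilon>)"
    and rs: "\<And>k. k < s \<Longrightarrow> is_O R PR 0 (\<lambda>\<epsilon>. rs \<epsilon> k)"
    and gs: "\<And>k. k < s \<Longrightarrow> \<forall>\<^sub>F \<epsilon> in at_right 0. gs \<epsilon> k \<in> G"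
    and gn: "is_O G PG 0 gn"
    and gn_prepared: "A $$ (0, 0) = 0 \<Longrightarrow> is_O G PG 1 gn"
    and gn_avg: "\<forall>\<^sub>F \<epsilon> in at_right 0. \<forall>x. avg \<mu> M (\<lambda>v. gn \<epsilon> (x, v)) = 0"
begin

text \<open>Gathers all that is used at a fixed small \<epsilon>; the stages are finitely many, so
  their thresholds can be merged.\<close>

lemma eventually_regular:
  "\<forall>\<^sub>F \<epsilon> in at_right 0. 0 < \<epsilon> \<and>
    imex_step \<mu> M D L s At A dt \<epsilon> (rn \<epsilon>) (gn \<epsilon>) (rs \<epsilon>) (gs \<epsilon>) (rn' \<epsilon>) (gn' \<epsilon>) \<and>
    gn \<epsilon> \<in> G \<and> (\<forall>k<s. gs \<epsilon> k \<in> G \<and> rs \<epsilon> k \<in> R \<and> (\<forall>x. avg \<mu> M (\<lambda>v. gs \<epsilon> k (x, v)) = 0))"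
proof -
  have "\<forall>\<^sub>F \<epsilon> in at_right 0. \<forall>k\<in>{..<s}. gs \<epsilon> k \<in> G \<and> rs \<epsilon> k \<in> R"
    using gs rs by (intro eventually_ball_finite) (auto simp: is_O_def eventually_conj)
  moreover have "\<forall>\<^sub>F \<epsilon> in at_right 0. gn \<epsilon> \<in> G" using gn by (simp add: is_O_def)
  ultimately show ?thesis using step gn_avg eventually_at_right_less[of "0::real"]
  proof eventually_elim
    case (elim \<epsilon>)
    then show ?case using stage_average_zero[OF elim(3)] by simp
  qed
qed

text \<open>The two claims need a joint induction: the bound on a stage uses the formula for
  \<open>L\<close> on earlier stages, and that formula is then obtained for the stage itself from
  its bound.\<close>

lemma stage_estimate:
  assumes "j < s" "A $$ (j, j) \<noteq> 0"
  shows "is_O G PG 1 (\<lambda>\<epsilon>. gs \<epsilon> j) \<and> (\<exists>q. is_O G PG 2 q \<and> (\<forall>\<^sub>F \<epsilon> in at_right 0. \<forall>x. AE v in \<mu>.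
    L (\<lambda>v. gs \<epsilon> j (x, v)) v = q \<epsilon> (x, v) + \<epsilon> * drift M (rs \<epsilon> j) (x, v)))"
  using assms
proof (induction j rule: less_induct)
  case (less j)
  define a where "a = A $$ (j, j) * dt"
  have a: "a \<noteq> 0" using less.prems dt by (simp add: a_def)
  \<comment> \<open>For stages without implicit part the zero family is a placeholder, so that a
    remainder can be chosen for every \<open>k < j\<close>.\<close>
  have "\<exists>q. is_O G PG 2 q \<and> (A $$ (k, k) \<noteq> 0 \<longrightarrow> (\<forall>\<^sub>F \<epsilon> in at_right 0. \<forall>x. AE v in \<mu>.
      L (\<lambda>v. gs \<epsilon> k (x, v)) v = q \<epsilon> (x, v) + \<epsilon> * drift M (rs \<epsilon> k) (x, v)))" if "k < j" for k
  proof (cases "A $$ (k, k) = 0")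
    case True
    then show ?thesis using micro.is_O_zero by blast
  next
    case False
    then show ?thesis using less.IH[OF that] that less.prems by simp
  qed
  then have "\<forall>k\<in>{..<j}. \<exists>q. is_O G PG 2 q \<and> (A $$ (k, k) \<noteq> 0 \<longrightarrow> (\<forall>\<^sub>F \<epsilon> in at_right 0. \<forall>x. AE v in \<mu>.
      L (\<lambda>v. gs \<epsilon> k (x, v)) v = q \<epsilon> (x, v) + \<epsilon> * drift M (rs \<epsilon> k) (x, v)))"
    by simp
  from bchoice[OF this] obtain q where
    q': "\<forall>k\<in>{..<j}. is_O G PG 2 (q k) \<and> (A $$ (k, k) \<noteq> 0 \<longrightarrow> (\<forall>\<^sub>F \<epsilon> in at_right 0. \<forall>x. AE v in \<mu>.
      L (\<lambda>v. gs \<epsilon> k (x, v)) v = q k \<epsilon> (x, v) + \<epsilon> * drift M (rs \<epsilon> k) (x, v)))" ..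
  then have q: "is_O G PG 2 (q k)" if "k < j" for k using that by blast
  have Lq: "\<forall>\<^sub>F \<epsilon> in at_right 0. \<forall>x. AE v in \<mu>.
      L (\<lambda>v. gs \<epsilon> k (x, v)) v = q k \<epsilon> (x, v) + \<epsilon> * drift M (rs \<epsilon> k) (x, v)"
    if "k < j" "A $$ (k, k) \<noteq> 0" for k
    using q' that by blast
  \<comment> \<open>A stage without implicit part equals \<open>gn\<close> only almost everywhere, which the seminorms may not
    respect; the estimates are therefore made with \<open>gn\<close> itself in its place.\<close>
  define gh where "gh \<epsilon> k = (if A $$ (k, k) = 0 then gn \<epsilon> else gs \<epsilon> k)" for \<epsilon> k
  have gh: "is_O G PG 1 (\<lambda>\<epsilon>. gh \<epsilon> k)" if "k < j" for k
  proof (cases "A $$ (k, k) = 0")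
    case True
    moreover have "k = 0" using degenerate_stage[OF _ _ True] that less.prems by simp
    ultimately show ?thesis using gn_prepared by (simp add: gh_def)
  next
    case False
    then show ?thesis using less.IH[OF that] that less.prems by (simp add: gh_def)
  qed

  \<comment> \<open>\<open>Q\<close> is the part of order 2: \<open>\<epsilon> ^ 2\<close> times
    bounded data, \<epsilon> times transport terms of order 1, and the earlier remainders. The drift
    \<open>d\<close> is the only term of order 1. The exponent in \<open>\<epsilon> ^ 1\<close> fits
    \<open>is_O_power_scale\<close>.\<close>
  define Q where "Q \<epsilon> z = \<epsilon> ^ 2 * gn \<epsilon> z
      - \<epsilon> ^ 1 * (\<Sum>k<j. dt * At $$ (j, k) * micro_transport \<mu> M (gh \<epsilon> k) z)
      + (\<Sum>k<j. dt * A $$ (j, k) * q k \<epsilon> z)" for \<epsilon> z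
  define d where "d \<epsilon> z = \<epsilon> ^ 1 * drift M (rs \<epsilon> j) z" for \<epsilon> z
  have "is_O G PG 2 (\<lambda>\<epsilon> z. \<epsilon> ^ 2 * gn \<epsilon> z)"
    using micro.is_O_power_scale[OF gn, of 2] by simp
  moreover have "is_O G PG (1 + 1) (\<lambda>\<epsilon> z. \<epsilon> ^ 1 *
      (\<Sum>k<j. dt * At $$ (j, k) * micro_transport \<mu> M (gh \<epsilon> k) z))"
    by (intro micro.is_O_power_scale micro.is_O_sum micro.is_O_const_scale
        is_O_stable[OF micro_transport_O_stable] gh) simp
  moreover have "is_O G PG 2 (\<lambda>\<epsilon> z. \<Sum>k<j. dt * A $$ (j, k) * q k \<epsilon> z)"
    by (intro micro.is_O_sum micro.is_O_const_scale q) simp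
  ultimately have Q: "is_O G PG 2 Q"
    unfolding Q_def by (intro micro.is_O_add micro.is_O_diff) (simp_all add: numeral_2_eq_2)
  have d: "is_O G PG 1 d"
    unfolding d_def
    using micro.is_O_power_scale[OF is_O_stable[OF drift_O_stable rs[OF less.prems(1)]], of 1] by simp
  define f where "f \<epsilon> z = Q \<epsilon> z - a * d \<epsilon> z" for \<epsilon> z
  have f: "is_O G PG 1 f"
    unfolding f_def
    by (intro micro.is_O_diff micro.is_O_const_scale d micro.is_O_mono[OF Q]) simp

  have "\<forall>\<^sub>F \<epsilon> in at_right 0. \<forall>k\<in>{k\<in>{..<j}. A $$ (k, k) \<noteq> 0}. \<forall>x. AE v in \<mu>.
      L (\<lambda>v. gs \<epsilon> k (x, v)) v = q k \<epsilon> (x, v) + \<epsilon> * drift M (rs \<epsilon> k) (x, v)"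
    by (intro eventually_ball_finite ballI Lq) auto
  then have equation: "\<forall>\<^sub>F \<epsilon> in at_right 0. \<forall>x. AE v in \<mu>.
      \<epsilon>\<^sup>2 * gs \<epsilon> j (x, v) - a * L (\<lambda>v. gs \<epsilon> j (x, v)) v = f \<epsilon> (x, v)"
    using eventually_regular
  proof eventually_elim
    case (elim \<epsilon>)
    then have stp: "imex_step \<mu> M D L s At A dt \<epsilon> (rn \<epsilon>) (gn \<epsilon>) (rs \<epsilon>) (gs \<epsilon>) (rn' \<epsilon>) (gn' \<epsilon>)"
      and G: "gn \<epsilon> \<in> G" "\<And>k. k < s \<Longrightarrow> gs \<epsilon> k \<in> G" and e: "0 < \<epsilon>" by auto
    have T: "AE v in \<mu>. micro_transport \<mu> M (gs \<epsilon> k) (x, v) = micro_transport \<mu> M (gh \<epsilon> k) (x, v)"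
      if "k < j" for k x
    proof (cases "A $$ (k, k) = 0")
      case True
      have k: "k < s" using that less.prems by simp
      have "k = 0" using degenerate_stage[OF k k True] by simp
      \<comment> \<open>For \<open>k = 0\<close> the explicit sum is empty and the single implicit
        coefficient is zero.\<close>
      then have "AE v in \<mu>. gs \<epsilon> k (x, v) = gn \<epsilon> (x, v)" for x
        using stage_equation[OF stp k, of x] True by simp
      from micro_transport_cong_AE[OF G(2)[OF k] G(1) this] True show ?thesis
        by (simp add: gh_def)
    qed (simp add: gh_def)
    have q: "AE v in \<mu>. L (\<lambda>v. gs \<epsilon> k (x, v)) v = q k \<epsilon> (x, v) + \<epsilon> * drift M (rs \<epsilon> k) (x, v)"
      if "k < j" "A $$ (j, k) \<noteq> 0" for k x
    proof -
      \<comment> \<open>A stage with vanishing diagonal entry has a vanishing column, hence cannot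
        occur with nonzero coefficient in row \<open>j\<close>.\<close>
      have "A $$ (k, k) \<noteq> 0" using that less.prems degenerate_stage[of k j] by auto
      then show ?thesis using elim(1) that(1) by simp
    qed
    show ?case
      unfolding f_def Q_def d_def a_def power_one_right
      by (intro allI stage_resolvent[OF stp less.prems(1) e] T q)
  qed

  have solution: "\<forall>\<^sub>F \<epsilon> in at_right 0. gs \<epsilon> j \<in> G \<and> (\<forall>x. is_inverse_image \<mu> M D
      (\<lambda>h v. \<epsilon>\<^sup>2 * h v - A $$ (j, j) * dt * L h v) (\<lambda>v. f \<epsilon> (x, v)) (\<lambda>v. gs \<epsilon> j (x, v)))"
    using equation eventually_regular
  proof eventually_elim
    case (elim \<epsilon>)
    then have "(\<lambda>v. gs \<epsilon> j (x, v)) \<in> D" for x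
      using stage_mem_D[OF _ less.prems(1)] by blast
    moreover have "gs \<epsilon> j \<in> G" "avg \<mu> M (\<lambda>v. gs \<epsilon> j (x, v)) = 0" for x
      using elim(2) less.prems(1) by blast+
    ultimately show ?case using elim(1) unfolding is_inverse_image_def a_def by simp
  qed
  \<comment> \<open>The average of \<open>f\<close> is read off from the equation it satisfies,
    because the induction hypothesis says nothing about the averages of the
    \<open>q k\<close>.\<close>
  have "\<forall>\<^sub>F \<epsilon> in at_right 0. f \<epsilon> \<in> G" using f by (simp add: is_O_def)
  then have "\<forall>\<^sub>F \<epsilon> in at_right 0. \<forall>x. avg \<mu> M (\<lambda>v. f \<epsilon> (x, v)) = 0"
    using equation eventually_regular
  proof eventually_elim
    case (elim \<epsilon>)
    have "avg \<mu> M (\<lambda>v. f \<epsilon> (x, v)) = 0" for x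
    proof -
      have D: "(\<lambda>v. gs \<epsilon> j (x, v)) \<in> D" using elim(3) less.prems by (auto dest: stage_mem_D)
      have int: "integrable \<mu> (\<lambda>v. \<epsilon>\<^sup>2 * gs \<epsilon> j (x, v))" "integrable \<mu> (\<lambda>v. a * L (\<lambda>v. gs \<epsilon> j (x, v)) v)"
        using wL2_integrable[OF D_wL2[OF D]] wL2_integrable[OF L_maps_to[OF D]] by simp_all
      have "avg \<mu> M (\<lambda>v. \<epsilon>\<^sup>2 * gs \<epsilon> j (x, v) - a * L (\<lambda>v. gs \<epsilon> j (x, v)) v) = 0"
        unfolding avg_diff[OF int] avg_scale using elim(3) less.prems avg_L[OF D] by simp
      moreover have "avg \<mu> M (\<lambda>v. \<epsilon>\<^sup>2 * gs \<epsilon> j (x, v) - a * L (\<lambda>v. gs \<epsilon> j (x, v)) v)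
          = avg \<mu> M (\<lambda>v. f \<epsilon> (x, v))"
      proof (rule avg_cong_AE)
        show "(\<lambda>v. \<epsilon>\<^sup>2 * gs \<epsilon> j (x, v) - a * L (\<lambda>v. gs \<epsilon> j (x, v)) v) \<in> borel_measurable \<mu>"
          using int by (intro borel_measurable_integrable Bochner_Integration.integrable_diff)
        show "AE v in \<mu>. \<epsilon>\<^sup>2 * gs \<epsilon> j (x, v) - a * L (\<lambda>v. gs \<epsilon> j (x, v)) v = f \<epsilon> (x, v)"
          using elim(2) by blast
      qed (rule wL2_measurable[OF G_wL2[OF elim(1)]])
      ultimately show ?thesis by simp
    qed
    then show ?case by blast
  qed
  then have small: "is_O G PG 1 (\<lambda>\<epsilon>. gs \<epsilon> j)"
    using solution by (rule inverse_O_stableD(2)[OF stable_resolvent[OF less.prems] f])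

  \<comment> \<open>Second reading of the equation: solved for \<open>L\<close>, it gives
    \<open>(\<epsilon> ^ 2 * gs \<epsilon> j - Q) / a\<close> plus the drift, and the bound just
    proved makes the first term negligible.\<close>
  define r where "r \<epsilon> z = (1 / a) * (\<epsilon> ^ 2 * gs \<epsilon> j z - Q \<epsilon> z)" for \<epsilon> z
  have "is_O G PG 2 (\<lambda>\<epsilon> z. \<epsilon> ^ 2 * gs \<epsilon> j z)"
    by (rule micro.is_O_mono[OF micro.is_O_power_scale[OF small]]) simp
  then have "is_O G PG 2 r"
    unfolding r_def by (intro micro.is_O_const_scale micro.is_O_diff Q)
  moreover have "\<forall>\<^sub>F \<epsilon> in at_right 0. \<forall>x. AE v in \<mu>.
      L (\<lambda>v. gs \<epsilon> j (x, v)) v = r \<epsilon> (x, v) + \<epsilon> * drift M (rs \<epsilon> j) (x, v)"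
    using equation
  proof eventually_elim
    case (elim \<epsilon>)
    have "AE v in \<mu>. L (\<lambda>v. gs \<epsilon> j (x, v)) v = r \<epsilon> (x, v) + \<epsilon> * drift M (rs \<epsilon> j) (x, v)" for x
      using elim[rule_format, of x]
      by eventually_elim (use a in \<open>simp add: r_def f_def d_def field_simps\<close>)
    then show ?case by blast
  qed
  ultimately show ?case using small by blast
qed

text \<open>The expression equals the divergence of the flux of \<open>w\<close>, divided by
  \<epsilon>, where \<open>w\<close> is the inverse image under \<open>L\<close> of the remainder of
  order 2. One order is lost in the division.\<close>

lemma divergence_flux_limit:
  assumes j: "j < s" "A $$ (j, j) \<noteq> 0"
  shows "is_O R PR 1 (\<lambda>\<epsilon> x. divergence (flux \<mu> M (gs \<epsilon> j)) x / \<epsilon>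
    + divergence (\<lambda>y. \<kappa> *v grad (rs \<epsilon> j) y) x)"
proof -
  obtain q where q: "is_O G PG 2 q"
    and Lq: "\<forall>\<^sub>F \<epsilon> in at_right 0. \<forall>x. AE v in \<mu>.
      L (\<lambda>v. gs \<epsilon> j (x, v)) v = q \<epsilon> (x, v) + \<epsilon> * drift M (rs \<epsilon> j) (x, v)"
    using stage_estimate[OF j] by blast
  have "\<forall>\<^sub>F \<epsilon> in at_right 0. q \<epsilon> \<in> G" using q by (simp add: is_O_def)
  \<comment> \<open>The remainder is the difference of an image under \<open>L\<close> and a drift
    term, both mean free, so the pseudo-inverse applies to it.\<close>
  then have "\<forall>\<^sub>F \<epsilon> in at_right 0. \<forall>x. avg \<mu> M (\<lambda>v. q \<epsilon> (x, v)) = 0"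
    using Lq eventually_regular
  proof eventually_elim
    case (elim \<epsilon>)
    have "avg \<mu> M (\<lambda>v. q \<epsilon> (x, v)) = 0" for x
    proof -
      have D: "(\<lambda>v. gs \<epsilon> j (x, v)) \<in> D" using elim(3) j by (auto dest: stage_mem_D)
      have "drift M (rs \<epsilon> j) \<in> G" using elim(3) j O_stable_maps[OF drift_O_stable] by blast
      then have int: "integrable \<mu> (\<lambda>v. q \<epsilon> (x, v))" "integrable \<mu> (\<lambda>v. \<epsilon> * drift M (rs \<epsilon> j) (x, v))"
        using G_integrable elim(1) by simp_all
      have "avg \<mu> M (\<lambda>v. q \<epsilon> (x, v)) = avg \<mu> M (\<lambda>v. q \<epsilon> (x, v) + \<epsilon> * drift M (rs \<epsilon> j) (x, v))"
        unfolding avg_add[OF int] by (simp add: avg_scale avg_drift)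
      also have "\<dots> = avg \<mu> M (L (\<lambda>v. gs \<epsilon> j (x, v)))"
      proof (intro avg_cong_AE)
        show "AE v in \<mu>. q \<epsilon> (x, v) + \<epsilon> * drift M (rs \<epsilon> j) (x, v) = L (\<lambda>v. gs \<epsilon> j (x, v)) v"
          using elim(2)[rule_format, of x] by eventually_elim simp
        show "(\<lambda>v. q \<epsilon> (x, v) + \<epsilon> * drift M (rs \<epsilon> j) (x, v)) \<in> borel_measurable \<mu>"
          using int by (intro borel_measurable_integrable Bochner_Integration.integrable_add)
      qed (rule wL2_measurable[OF L_maps_to[OF D]])
      finally show ?thesis by (simp add: avg_L[OF D])
    qed
    then show ?case by blast
  qed
  note inverse = inverse_O_stableD[OF stable_pseudo_inverse q this]
  from inverse(1) obtain w where w: "\<forall>\<^sub>F \<epsilon> in at_right 0. w \<epsilon> \<in> G \<and>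
      (\<forall>x. is_inverse_image \<mu> M D L (\<lambda>v. q \<epsilon> (x, v)) (\<lambda>v. w \<epsilon> (x, v)))" ..
  from w have "is_O G PG 2 w" by (rule inverse(2))
  then have "is_O G PG (Suc 1) w" by (simp add: numeral_2_eq_2)
  from macro.is_O_divide[OF is_O_stable[OF divergence_flux_O_stable this]]
  have "is_O R PR 1 (\<lambda>\<epsilon> x. divergence (flux \<mu> M (w \<epsilon>)) x / \<epsilon>)" .
  moreover have "\<forall>\<^sub>F \<epsilon> in at_right 0. (\<lambda>x. divergence (flux \<mu> M (w \<epsilon>)) x / \<epsilon>) =
      (\<lambda>x. divergence (flux \<mu> M (gs \<epsilon> j)) x / \<epsilon> + divergence (\<lambda>y. \<kappa> *v grad (rs \<epsilon> j) y) x)"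
    using w Lq eventually_regular
  proof eventually_elim
    case (elim \<epsilon>)
    have "divergence (flux \<mu> M (gs \<epsilon> j)) x
        = divergence (flux \<mu> M (w \<epsilon>)) x - \<epsilon> * divergence (\<lambda>y. \<kappa> *v grad (rs \<epsilon> j) y) x" for x
      using elim j
      by (intro divergence_flux_of_drift_solution[where q = "q \<epsilon>"]) (auto dest: stage_mem_D)
    moreover have "0 < \<epsilon>" using elim(3) by simp
    ultimately show ?case by (auto simp: field_simps)
  qed
  ultimately show ?thesis by (simp add: is_O_cong)
qed

text \<open>The residual is exactly a combination of the expressions from
  \<open>divergence_flux_limit\<close>; stages not covered there enter with coefficient
  zero.\<close>

lemma step_limit:
  assumes j: "j < s"
  shows "is_O R PR 1 (\<lambda>\<epsilon> x. rs \<epsilon> j x - (rn \<epsilon> x +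
      (\<Sum>k\<le>j. A $$ (j, k) * dt * divergence (\<lambda>y. \<kappa> *v grad (rs \<epsilon> k) y) x)))"
proof -
  have "is_O R PR 1 (\<lambda>\<epsilon> x. \<Sum>k\<le>j. - (A $$ (j, k) * dt) * (divergence (flux \<mu> M (gs \<epsilon> k)) x / \<epsilon>
    + divergence (\<lambda>y. \<kappa> *v grad (rs \<epsilon> k) y) x))"
  proof (rule macro.is_O_sum)
    fix k assume "k \<in> {..j}"
    then have k: "k < s" using j by simp
    show "is_O R PR 1 (\<lambda>\<epsilon> x. - (A $$ (j, k) * dt) * (divergence (flux \<mu> M (gs \<epsilon> k)) x / \<epsilon>
        + divergence (\<lambda>y. \<kappa> *v grad (rs \<epsilon> k) y) x))"
    proof (cases "A $$ (k, k) = 0")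
      case True
      then have "A $$ (j, k) = 0" using degenerate_stage[OF k j] by blast
      then show ?thesis by (simp add: macro.is_O_zero)
    next
      case False
      then show ?thesis by (intro macro.is_O_const_scale divergence_flux_limit k)
    qed
  qed
  moreover have "\<forall>\<^sub>F \<epsilon> in at_right 0. (\<lambda>x. \<Sum>k\<le>j. - (A $$ (j, k) * dt) *
        (divergence (flux \<mu> M (gs \<epsilon> k)) x / \<epsilon> + divergence (\<lambda>y. \<kappa> *v grad (rs \<epsilon> k) y) x)) =
      (\<lambda>x. rs \<epsilon> j x - (rn \<epsilon> x +
        (\<Sum>k\<le>j. A $$ (j, k) * dt * divergence (\<lambda>y. \<kappa> *v grad (rs \<epsilon> k) y) x)))"
    using step
  proof eventually_elim
    case (elim \<epsilon>)
    have "rs \<epsilon> j x = rn \<epsilon> x - (\<Sum>k\<le>j. A $$ (j, k) * (dt / \<epsilon>) * divergence (flux \<mu> M (gs \<epsilon> k)) x)" for x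
      using elim j by (simp add: imex_step_def)
    then show ?case
      by (intro ext) (simp add: distrib_left sum.distrib sum_negf sum_subtractf mult_ac)
  qed
  ultimately show ?thesis by (simp add: is_O_cong)
qed

text \<open>The new value is the last stage, so one step turns even merely bounded data, where these
  are allowed, into well-prepared ones.\<close>

lemma step_initial_data:
  assumes "A $$ (s - 1, s - 1) \<noteq> 0"
  shows "is_O G PG 1 gn'" "\<forall>\<^sub>F \<epsilon> in at_right 0. \<forall>x. avg \<mu> M (\<lambda>v. gn' \<epsilon> (x, v)) = 0"
proof -
  have last: "s - 1 < s" using stages by simp
  have eq: "\<forall>\<^sub>F \<epsilon> in at_right 0. gs \<epsilon> (s - 1) = gn' \<epsilon>"
    using step by eventually_elim (simp add: imex_step_def)
  show "is_O G PG 1 gn'"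
    using stage_estimate[OF last assms] is_O_cong[OF eq] by blast
  show "\<forall>\<^sub>F \<epsilon> in at_right 0. \<forall>x. avg \<mu> M (\<lambda>v. gn' \<epsilon> (x, v)) = 0"
    using eq eventually_regular by eventually_elim (use last in metis)
qed

end

end

subsection \<open>Lower triangular tableaux\<close>

text \<open>The determinant is the product of the diagonal entries and is nonzero by
  multiplicativity.\<close>

lemma lower_triangular_invertible_diag:
  fixes A :: "real mat"
  assumes A: "A \<in> carrier_mat n n" and tri: "\<And>i j. i < j \<Longrightarrow> j < n \<Longrightarrow> A $$ (i, j) = 0"
    and inv: "invertible_mat A" and k: "k < n"
  shows "A $$ (k, k) \<noteq> 0"
proof
  assume 0: "A $$ (k, k) = 0"
  obtain B where B: "A * B = 1\<^sub>m n" "B * A = 1\<^sub>m (dim_row B)"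
    using inv A unfolding invertible_mat_def inverts_mat_def by auto
  have "dim_col B = n" using arg_cong[OF B(1), of dim_col] by simp
  moreover have "dim_row B = n" using arg_cong[OF B(2), of dim_col] A by simp
  ultimately have "det A * det B = 1" using det_mult[OF A, of B] B(1) by auto
  moreover have "0 \<in> set (diag_mat A)" using 0 k A by (force simp: diag_mat_def)
  then have "det A = 0" using det_lower_triangular[OF tri A] by (simp add: prod_list_zero_iff)
  ultimately show False by simp
qed

lemma (in imex_method) type_A_diag:
  "type_A A \<Longrightarrow> k < s \<Longrightarrow> A $$ (k, k) \<noteq> 0"
  using lower_triangular_invertible_diag[OF implicit_dim implicit_part]
  by (simp add: type_A_def)

text \<open>Deleting the first row and column keeps the matrix lower triangular and shifts indices
  by one.\<close>

lemma (in imex_method) type_CK_ARS_diag: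
  assumes A: "type_CK_ARS s A" and k: "k < s" "0 < k"
  shows "A $$ (k, k) \<noteq> 0"
proof -
  have entry: "mat_delete A 0 0 $$ (i, j) = A $$ (Suc i, Suc j)" if "i < s - 1" "j < s - 1" for i j
    using that implicit_dim by (simp add: mat_delete_def)
  have "mat_delete A 0 0 $$ (k - 1, k - 1) \<noteq> 0"
  proof (rule lower_triangular_invertible_diag)
    show "mat_delete A 0 0 \<in> carrier_mat (s - 1) (s - 1)"
      using mat_delete_carrier[OF implicit_dim] .
    show "invertible_mat (mat_delete A 0 0)" using A by (simp add: type_CK_ARS_def)
    show "k - 1 < s - 1" using k by simp
    fix i j assume "i < j" "j < s - 1"
    then show "mat_delete A 0 0 $$ (i, j) = 0" using entry implicit_part by simp
  qed
  then show ?thesis using entry[of "k - 1" "k - 1"] k by simp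
qed

section \<open>Induction over the time steps\<close>

theorem theorem1:
  fixes \<mu> :: "(real^'d::finite) measure" and M :: "real^'d \<Rightarrow> real"
    and D :: "(real^'d \<Rightarrow> real) set" and L :: "(real^'d \<Rightarrow> real) \<Rightarrow> real^'d \<Rightarrow> real"
    and lo hi :: "real^'d"
    and R :: "(real^'d \<Rightarrow> real) set" and PR :: "((real^'d \<Rightarrow> real) \<Rightarrow> real) set"
    and G :: "((real^'d) \<times> (real^'d) \<Rightarrow> real) set"
    and PG :: "(((real^'d) \<times> (real^'d) \<Rightarrow> real) \<Rightarrow> real) set"
    and s :: nat and At A :: "real mat" and bt b :: "nat \<Rightarrow> real" and dt :: real
    and \<rho> :: "nat \<Rightarrow> real \<Rightarrow> real^'d \<Rightarrow> real"
    and g :: "nat \<Rightarrow> real \<Rightarrow> (real^'d) \<times> (real^'d) \<Rightarrow> real"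
    and \<rho>s :: "nat \<Rightarrow> real \<Rightarrow> nat \<Rightarrow> real^'d \<Rightarrow> real"
    and gs :: "nat \<Rightarrow> real \<Rightarrow> nat \<Rightarrow> (real^'d) \<times> (real^'d) \<Rightarrow> real"
  assumes setting: "asymptotic_setting \<mu> M D L lo hi R PR G PG"
    and tableau: "imex_method s At A"
    and gsa: "globally_stiffly_accurate s At A bt b"
    and dt: "0 < dt"
    and stable_resolvent: "\<And>j. j < s \<Longrightarrow> A $$ (j, j) \<noteq> 0 \<Longrightarrow>
        inverse_O_stable \<mu> M D G PG (\<lambda>\<epsilon> h v. \<epsilon>\<^sup>2 * h v - A $$ (j, j) * dt * L h v)"
    and scheme: "\<And>n. \<forall>\<^sub>F \<epsilon> in at_right 0.
        imex_step \<mu> M D L s At A dt \<epsilon> (\<rho> n \<epsilon>) (g n \<epsilon>) (\<rho>s n \<epsilon>) (gs n \<epsilon>) (\<rho> (Suc n) \<epsilon>) (g (Suc n) \<epsilon>)"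
    and average_zero: "\<forall>\<^sub>F \<epsilon> in at_right 0. \<forall>x. avg \<mu> M (\<lambda>v. g 0 \<epsilon> (x, v)) = 0"
    and \<rho>_bounded: "\<And>n. is_O R PR 0 (\<rho> n)"
    and \<rho>s_bounded: "\<And>n j. j < s \<Longrightarrow> is_O R PR 0 (\<lambda>\<epsilon>. \<rho>s n \<epsilon> j)"
    and g_smooth: "\<And>n. \<forall>\<^sub>F \<epsilon> in at_right 0. g n \<epsilon> \<in> G"
    and gs_smooth: "\<And>n j. j < s \<Longrightarrow> \<forall>\<^sub>F \<epsilon> in at_right 0. gs n \<epsilon> j \<in> G"
    and initial: "(type_A A \<and> is_O G PG 0 (g 0)) \<or> (type_CK_ARS s A \<and> is_O G PG 1 (g 0))"
  shows "\<forall>n. \<forall>j<s. is_O R PR 1 (\<lambda>\<epsilon> x. \<rho>s n \<epsilon> j x - (\<rho> n \<epsilon> x +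
      (\<Sum>k\<le>j. A $$ (j, k) * dt *
        divergence (\<lambda>y. diffusion_matrix \<mu> M D L *v grad (\<rho>s n \<epsilon> k) y) x)))"
proof -
  interpret setting: asymptotic_setting \<mu> M D L lo hi R PR G PG by (rule setting)
  interpret tableau: imex_method s At A by (rule tableau)
  have diag: "A $$ (k, k) \<noteq> 0" if "k < s" "type_A A \<or> 0 < k" for k
    using that initial tableau.type_A_diag tableau.type_CK_ARS_diag by blast
  have degenerate: "k = 0 \<and> A $$ (j, k) = 0" if "k < s" "j < s" "A $$ (k, k) = 0" for j k
  proof -
    have "k = 0" "\<not> type_A A" using diag that by auto
    with initial that(2) show ?thesis unfolding type_CK_ARS_def by blast
  qed
  interpret imex_asymptotics \<mu> M D L lo hi R PR G PG s At A dt
    using dt stable_resolvent degenerate by unfold_locales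
  \<comment> \<open>A vanishing last diagonal entry would leave a single stage with zero implicit
    coefficient, against the row sum 1 in stiff accuracy.\<close>
  have last: "A $$ (s - 1, s - 1) \<noteq> 0"
  proof
    assume 0: "A $$ (s - 1, s - 1) = 0"
    then have "s - 1 = 0" using degenerate[of "s - 1" "s - 1"] tableau.stages by simp
    then show False using 0 gsa by (simp add: globally_stiffly_accurate_def)
  qed
  \<comment> \<open>The invariant carried from step to step: order \<epsilon> is demanded only where
    the first stage needs it, which the initial data satisfy for either type.\<close>
  have data: "is_O G PG 0 (g n) \<and> (A $$ (0, 0) = 0 \<longrightarrow> is_O G PG 1 (g n)) \<and>
      (\<forall>\<^sub>F \<epsilon> in at_right 0. \<forall>x. avg \<mu> M (\<lambda>v. g n \<epsilon> (x, v)) = 0)" for n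
  proof (induction n)
    case 0
    have "is_O G PG 0 (g 0)" using initial setting.micro.is_O_mono[of 1 "g 0" 0] by auto
    moreover have "is_O G PG 1 (g 0)" if "A $$ (0, 0) = 0"
      using initial that diag[of 0] tableau.stages by auto
    ultimately show ?case using average_zero by blast
  next
    case (Suc n)
    note data = step_initial_data[OF scheme[of n] \<rho>s_bounded gs_smooth _ _ _ last]
    have "is_O G PG 1 (g (Suc n))" by (rule data(1)) (use Suc in auto)
    moreover have "\<forall>\<^sub>F \<epsilon> in at_right 0. \<forall>x. avg \<mu> M (\<lambda>v. g (Suc n) \<epsilon> (x, v)) = 0"
      by (rule data(2)) (use Suc in auto)
    ultimately show ?case using setting.micro.is_O_mono[of 1 "g (Suc n)" 0] by simp
  qed
  show ?thesis
  proof (intro allI impI)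
    fix n j assume "j < s"
    then show "is_O R PR 1 (\<lambda>\<epsilon> x. \<rho>s n \<epsilon> j x - (\<rho> n \<epsilon> x +
        (\<Sum>k\<le>j. A $$ (j, k) * dt *
          divergence (\<lambda>y. diffusion_matrix \<mu> M D L *v grad (\<rho>s n \<epsilon> k) y) x)))"
      by (intro step_limit[OF scheme[of n] \<rho>s_bounded gs_smooth]) (use data[of n] in auto)
  qed
qed

end
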